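(* Let $S$ and $\hat S$ be the exact and hybrid data augmentation kernels on $\mathsf X_1$ (defined in the context). Let $\gamma:\mathsf X_2\to[0,1]$ be a measurable function such that $\|Q_{1,z}\|_{\Pi_{1,z}}\le\gamma(z)$ for $M_2$-a.e. $z\in\mathsf X_2$. Suppose that there are a positive integer $t$ and a number $\alpha_t\in[0,1]$ such that $\int_{\mathsf X_2}\gamma(z)^t\,\Pi_{2,y}(dz)\le\alpha_t$ for $M_1$-a.e. $y\in\mathsf X_1$ and $\alpha_t\le(1-\|S\|_{M_1})/2$. Assume further that $t$ is even, or $S$ is positive semi-definite. Finally, assume that $\|S\|_{M_1}<1$. Then, for every $f\in L_0^2(M_1)$, $$\mathrm{var}_{\hat S}(f)\le 2t\,\mathrm{var}_S(f)+(2t-1)\|f\|_{M_1}^2.$$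
   Context: $L^2$ conventions. For a probability space $(\mathsf Y,\mathcal F,\omega)$, $L^2(\omega)$ is the real Hilbert space of square-integrable functions (modulo a.e. equality) with inner product $\langle f,g\rangle_\omega=\int fg\,d\omega$ and norm $\|\cdot\|_\omega$; $L_0^2(\omega)=\{f\in L^2(\omega):\int f\,d\omega=0\}$. A Markov transition kernel (Mtk) $K$ on $\mathsf Y$ reversible with respect to $\omega$ acts as a self-adjoint operator on $L_0^2(\omega)$ by $Kf(y)=\int K(y,dy')f(y')$; $\|K\|_\omega\in[0,1]$ is its operator norm on $L_0^2(\omega)$, and $K$ is positive semi-definite if it is self-adjoint and $\langle f,Kf\rangle_\omega\ge0$ for all $f\in L_0^2(\omega)$. The asymptotic variance of $f\in L^2(\omega)$ is $\mathrm{var}_K(f)=\lim_{n\to\infty}n^{-1}\,\mathrm{var}\big[\sum_{s=1}^n f(X(s))\big]$, where $(X(s))_{s\ge0}$ is the chain with kernel $K$ and $X(0)\sim\omega$; when $\|K\|_\omega<1$ and $f\in L_0^2(\omega)$, it equals $2\langle f,(I-K)^{-1}f\rangle_\omega-\|f\|_\omega^2$, with $I$ the identity on $L_0^2(\omega)$. Data augmentation setting. $\mathsf X_1,\mathsf X_2$ are Polish spaces with Borel $\sigma$-algebras $\mathcal B_1,\mathcal B_2$, and $\Pi$ is a probability measure on $\mathsf X_1\times\mathsf X_2$. For $(X_1,X_2)\sim\Pi$, $M_1,M_2$ are the marginal distributions of $X_1,X_2$; $\Pi_{2,y}$ is the conditional distribution of $X_2$ given $X_1=y$; $\Pi_{1,z}$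 is the conditional distribution of $X_1$ given $X_2=z$. For each $z\in\mathsf X_2$, $Q_{1,z}:\mathsf X_1\times\mathcal B_1\to[0,1]$ is an Mtk reversible with respect to $\Pi_{1,z}$, and $(y,z)\mapsto Q_{1,z}(y,A)$ is measurable for every $A\in\mathcal B_1$. Define $$S(y,dy')=\int_{\mathsf X_2}\Pi_{2,y}(dz)\,\Pi_{1,z}(dy'),\qquad \hat S(y,dy')=\int_{\mathsf X_2}\Pi_{2,y}(dz)\,Q_{1,z}(y,dy').$$ Both are reversible with respect to $M_1$, and $S$ is known to be positive semi-definite on $L_0^2(M_1)$. *)

theory Defs
  imports "HOL-Probability.Probability"
begin

section \<open>Markov transition kernels\<close>

definition markov_kernel :: "('a::topological_space \<Rightarrow> 'b::topological_space measure) \<Rightarrow> bool" where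
  "markov_kernel K \<longleftrightarrow> K \<in> borel \<rightarrow>\<^sub>M prob_algebra borel"

definition reversible :: "'a::topological_space measure \<Rightarrow> ('a \<Rightarrow> 'a measure) \<Rightarrow> bool" where
  "reversible \<omega> K \<longleftrightarrow> (\<forall>A\<in>sets borel. \<forall>B\<in>sets borel.
     (\<integral>\<^sup>+ y \<in> A. emeasure (K y) B \<partial>\<omega>) = (\<integral>\<^sup>+ y \<in> B. emeasure (K y) A \<partial>\<omega>))"

text \<open>A version of the regular conditional distribution of \<open>X\<close> given \<open>Y\<close> under the law \<open>P\<close>.\<close>

definition cond_distribution ::
  "'w measure \<Rightarrow> ('w \<Rightarrow> 'a::topological_space) \<Rightarrow> ('w \<Rightarrow> 'b::topological_space)
    \<Rightarrow> ('b \<Rightarrow> 'a measure) \<Rightarrow> bool" where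
  "cond_distribution P X Y \<kappa> \<longleftrightarrow> markov_kernel \<kappa> \<and>
     (\<forall>A\<in>sets borel. \<forall>B\<in>sets borel.
        emeasure P {w \<in> space P. X w \<in> A \<and> Y w \<in> B}
          = (\<integral>\<^sup>+ y \<in> B. emeasure (\<kappa> y) A \<partial>distr P borel Y))"


section \<open>Kernels as operators on mean-zero square-integrable functions\<close>

text \<open>Elements of \<open>L\<^sup>2(\<omega>)\<close> are represented by measurable functions; everything
  below is invariant under modification on null sets.\<close>

definition L2_0 :: "'a measure \<Rightarrow> ('a \<Rightarrow> real) set" where
  "L2_0 \<omega> = {f \<in> borel_measurable \<omega>. integrable \<omega> (\<lambda>x. (f x)\<^sup>2) \<and> (\<integral>x. f x \<partial>\<omega>) = 0}"

definition L2_inner :: "'a measure \<Rightarrow> ('a \<Rightarrow> real) \<Rightarrow> ('a \<Rightarrow> real) \<Rightarrow> real" where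
  "L2_inner \<omega> f g = (\<integral>x. f x * g x \<partial>\<omega>)"

definition L2_norm :: "'a measure \<Rightarrow> ('a \<Rightarrow> real) \<Rightarrow> real" where
  "L2_norm \<omega> f = sqrt (L2_inner \<omega> f f)"

definition kernel_op :: "('a \<Rightarrow> 'a measure) \<Rightarrow> ('a \<Rightarrow> real) \<Rightarrow> 'a \<Rightarrow> real" where
  "kernel_op K f y = (\<integral>x. f x \<partial>K y)"

text \<open>The supremum is taken over a bounded set when \<open>K\<close> is reversible with respect to
  the probability measure \<open>\<omega>\<close>, as \<open>kernel_op K\<close> is then a contraction. The set
  contains \<open>0\<close>, so the norm is \<open>0\<close> if \<open>L2_0 \<omega>\<close> is trivial.\<close>

definition kernel_norm :: "'a measure \<Rightarrow> ('a \<Rightarrow> 'a measure) \<Rightarrow> real" where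
  "kernel_norm \<omega> K = (SUP f \<in> {f \<in> L2_0 \<omega>. L2_norm \<omega> f \<le> 1}. L2_norm \<omega> (kernel_op K f))"

definition positive_semidefinite :: "'a measure \<Rightarrow> ('a \<Rightarrow> 'a measure) \<Rightarrow> bool" where
  "positive_semidefinite \<omega> K \<longleftrightarrow>
     (\<forall>f\<in>L2_0 \<omega>. \<forall>g\<in>L2_0 \<omega>. L2_inner \<omega> (kernel_op K f) g = L2_inner \<omega> f (kernel_op K g)) \<and>
     (\<forall>f\<in>L2_0 \<omega>. 0 \<le> L2_inner \<omega> f (kernel_op K f))"


section \<open>Markov chains and asymptotic variance\<close>

definition chain_step :: "'a measure \<Rightarrow> ('a \<Rightarrow> 'a measure) \<Rightarrow> nat \<Rightarrow> (nat \<Rightarrow> 'a) \<Rightarrow> 'a measure" where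
  "chain_step \<omega> K n x = (if n = 0 then \<omega> else K (x (n - 1)))"

text \<open>Law on path space of the chain with kernel \<open>K\<close> started from \<open>\<omega>\<close>,
  obtained from the Ionescu-Tulcea theorem; \<open>X(s)\<close> is the coordinate map \<open>\<lambda>x. x s\<close>.\<close>

definition chain_law ::
  "'a::topological_space measure \<Rightarrow> ('a \<Rightarrow> 'a measure) \<Rightarrow> (nat \<Rightarrow> 'a) measure" where
  "chain_law \<omega> K = projective_family.lim UNIV
     (Ionescu_Tulcea.CI (chain_step \<omega> K) (\<lambda>_. borel)) (\<lambda>_. borel)"

lemma Ionescu_Tulcea_chain_step:
  fixes \<omega> :: "'a::topological_space measure"
  assumes "prob_space \<omega>" "sets \<omega> = sets borel" "markov_kernel K"
  shows "Ionescu_Tulcea (chain_step \<omega> K) (\<lambda>_. borel)"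
proof (rule Ionescu_Tulcea.intro)
  have K: "K \<in> borel \<rightarrow>\<^sub>M prob_algebra borel"
    using assms(3) by (simp add: markov_kernel_def)
  have \<omega>: "\<omega> \<in> space (prob_algebra borel)"
    using assms(1,2) by (simp add: space_prob_algebra)
  have M: "chain_step \<omega> K i \<in> PiM {0..<i} (\<lambda>_. borel) \<rightarrow>\<^sub>M prob_algebra borel" for i
  proof (cases "i = 0")
    case True
    then show ?thesis
      using \<omega> by (simp add: chain_step_def[abs_def])
  next
    case False
    then have "(\<lambda>x. x (i - 1)) \<in> PiM {0..<i} (\<lambda>_. borel :: 'a measure) \<rightarrow>\<^sub>M borel"
      by (intro measurable_component_singleton) auto
    from measurable_compose[OF this K] False show ?thesis
      by (simp add: chain_step_def[abs_def])
  qed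
  fix i
  show "chain_step \<omega> K i \<in> PiM {0..<i} (\<lambda>_. borel) \<rightarrow>\<^sub>M subprob_algebra borel"
    using M by (rule measurable_prob_algebraD)
  fix x :: "nat \<Rightarrow> 'a"
  assume "x \<in> space (PiM {0..<i} (\<lambda>_. borel))"
  from measurable_space[OF M this] show "prob_space (chain_step \<omega> K i x)"
    by (simp add: space_prob_algebra)
qed

text \<open>The limit is taken in the extended reals because it may be infinite in general.\<close>

definition asymp_var ::
  "'a::topological_space measure \<Rightarrow> ('a \<Rightarrow> 'a measure) \<Rightarrow> ('a \<Rightarrow> real) \<Rightarrow> ereal" where
  "asymp_var \<omega> K f = lim (\<lambda>n. ereal
     (prob_space.variance (chain_law \<omega> K) (\<lambda>x. \<Sum>s=1..n. f (x s)) / real n))"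


section \<open>Data augmentation kernels\<close>

definition DA_exact :: "('b \<Rightarrow> 'a measure) \<Rightarrow> ('a \<Rightarrow> 'b measure) \<Rightarrow> 'a \<Rightarrow> 'a measure" where
  "DA_exact P1 P2 y = P2 y \<bind> P1"

definition DA_hybrid :: "('b \<Rightarrow> 'a \<Rightarrow> 'a measure) \<Rightarrow> ('a \<Rightarrow> 'b measure) \<Rightarrow> 'a \<Rightarrow> 'a measure" where
  "DA_hybrid Q P2 y = P2 y \<bind> (\<lambda>z. Q z y)"

end

theory Submission
  imports Defs
begin

text \<open>
  Disintegrating over \<open>z\<close> writes \<open>\<langle>f, S_hat f\<rangle>\<close>, \<open>\<langle>f, S f\<rangle>\<close> and \<open>\<parallel>f\<parallel>\<^sup>2\<close> as integrals over
  the fibres \<open>L\<^sup>2(\<Pi>\<^sub>1\<^sub>,\<^sub>z)\<close> of \<open>\<langle>f, Q\<^sub>1\<^sub>,\<^sub>z f\<rangle>\<close>, of the squared mean \<open>m(z)\<^sup>2\<close> and of \<open>\<parallel>f\<parallel>\<^sup>2\<close>.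
  On a fibre, \<open>\<bar>\<langle>f, Q\<^sub>1\<^sub>,\<^sub>z f\<rangle> - m\<^sup>2\<bar> \<le> \<gamma> (\<parallel>f\<parallel>\<^sup>2 - m\<^sup>2)\<close>, and Bernoulli's inequality
  \<open>1 - \<gamma>\<^sup>t \<le> t (1 - \<gamma>)\<close> brings in \<open>\<gamma>\<^sup>t\<close>, whose contribution is at most
  \<open>\<alpha> \<parallel>f\<parallel>\<^sup>2 \<le> \<langle>f, (I - S) f\<rangle> / 2\<close>. This yields \<open>I - S \<le> 2t (I - S_hat)\<close> and, by the same argument
  for \<open>I + S_hat\<close>, a spectral gap of \<open>S_hat\<close> at both ends. Inverting the operator inequality gives
  \<open>\<langle>f, (I - S_hat)\<^sup>-\<^sup>1 f\<rangle> \<le> 2t \<langle>f, (I - S)\<^sup>-\<^sup>1 f\<rangle>\<close>, which is the claim because the asymptotic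
  variance is \<open>2 \<Sum>\<^sub>k \<langle>f, K\<^sup>k f\<rangle> - \<parallel>f\<parallel>\<^sup>2\<close> for a kernel \<open>K\<close> with \<open>\<parallel>K\<parallel> < 1\<close>.
\<close>

section \<open>Markov kernels and joint laws\<close>

text \<open>Fubini for a mixture and a signed integrand. The positive and negative parts fall under
  \<open>nn_integral_bind\<close>, and a finite total integral makes both inner integrals finite
  almost everywhere.\<close>

lemma
  fixes g :: "'b \<Rightarrow> real"
  assumes K: "K \<in> M \<rightarrow>\<^sub>M subprob_algebra N"
    and g: "g \<in> borel_measurable N" and int: "integrable (M \<bind> K) g"
  shows AE_integrable_bind: "AE x in M. integrable (K x) g"
    and integrable_integral_bind: "integrable M (\<lambda>x. \<integral>y. g y \<partial>K x)"
    and integral_bind_eq: "(\<integral>y. g y \<partial>(M \<bind> K)) = (\<integral>x. (\<integral>y. g y \<partial>K x) \<partial>M)"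
proof -
  note [measurable] = K g
  note nn_integral_measurable_subprob_algebra2[OF _ K, measurable]
  define p where "p x = (\<integral>\<^sup>+y. ennreal (g y) \<partial>K x)" for x
  define n where "n x = (\<integral>\<^sup>+y. ennreal (- g y) \<partial>K x)" for x
  have [measurable]: "p \<in> borel_measurable M" "n \<in> borel_measurable M"
    unfolding p_def n_def by measurable
  have P: "(\<integral>\<^sup>+y. ennreal (g y) \<partial>(M \<bind> K)) = (\<integral>\<^sup>+x. p x \<partial>M)"
    and N: "(\<integral>\<^sup>+y. ennreal (- g y) \<partial>(M \<bind> K)) = (\<integral>\<^sup>+x. n x \<partial>M)"
    unfolding p_def n_def by (rule nn_integral_bind[OF _ K]; measurable)+
  have fin: "(\<integral>\<^sup>+x. p x \<partial>M) \<noteq> \<infinity>" "(\<integral>\<^sup>+x. n x \<partial>M) \<noteq> \<infinity>"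
    using int unfolding P[symmetric] N[symmetric] real_integrable_def by auto
  have ae: "AE x in M. p x \<noteq> \<infinity>" "AE x in M. n x \<noteq> \<infinity>"
    by (rule nn_integral_PInf_AE[OF _ fin(1)] nn_integral_PInf_AE[OF _ fin(2)]; measurable)+
  have meas: "g \<in> borel_measurable (K x)" if "x \<in> space M" for x
    by (subst measurable_cong_sets[OF sets_kernel[OF K that] refl]) (rule g)
  show "AE x in M. integrable (K x) g"
    using ae AE_space by eventually_elim (auto simp: real_integrable_def p_def n_def meas)
  have ip: "(\<integral>\<^sup>+x. ennreal (enn2real (p x)) \<partial>M) = (\<integral>\<^sup>+x. p x \<partial>M)"
    using ae(1) by (intro nn_integral_cong_AE) (auto simp: less_top)
  have "(\<integral>\<^sup>+x. ennreal (enn2real (n x)) \<partial>M) = (\<integral>\<^sup>+x. n x \<partial>M)"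
    using ae(2) by (intro nn_integral_cong_AE) (auto simp: less_top)
  note i_n = this
  have intp: "integrable M (\<lambda>x. enn2real (p x))"
    using fin(1) ip by (intro integrableI_nonneg) (auto simp: less_top)
  have intn: "integrable M (\<lambda>x. enn2real (n x))"
    using fin(2) i_n by (intro integrableI_nonneg) (auto simp: less_top)
  \<comment> \<open>Only almost everywhere: where \<open>g\<close> is not integrable the left side
    is 0 by default, and the right side need not be.\<close>
  have eq: "AE x in M. (\<integral>y. g y \<partial>K x) = enn2real (p x) - enn2real (n x)"
    using \<open>AE x in M. integrable (K x) g\<close>
    by eventually_elim (simp add: real_lebesgue_integral_def p_def n_def)
  have mi: "(\<lambda>x. \<integral>y. g y \<partial>K x) \<in> borel_measurable M"
    using measurable_compose[OF K integral_measurable_subprob_algebra[OF g]] .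
  show "integrable M (\<lambda>x. \<integral>y. g y \<partial>K x)"
    by (subst integrable_cong_AE[OF mi _ eq]) (auto intro: intp intn)
  have "(\<integral>x. (\<integral>y. g y \<partial>K x) \<partial>M) = (\<integral>x. enn2real (p x) - enn2real (n x) \<partial>M)"
    by (rule integral_cong_AE[OF mi _ eq]) measurable
  also have "\<dots> = (\<integral>x. enn2real (p x) \<partial>M) - (\<integral>x. enn2real (n x) \<partial>M)"
    by (rule Bochner_Integration.integral_diff[OF intp intn])
  also have "\<dots> = enn2real (\<integral>\<^sup>+x. p x \<partial>M) - enn2real (\<integral>\<^sup>+x. n x \<partial>M)"
    by (subst (1 2) integral_eq_nn_integral) (auto simp: ip i_n)
  also have "\<dots> = (\<integral>y. g y \<partial>(M \<bind> K))"
    by (simp add: real_lebesgue_integral_def[OF int] P N)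
  finally show "(\<integral>y. g y \<partial>(M \<bind> K)) = (\<integral>x. (\<integral>y. g y \<partial>K x) \<partial>M)" ..
qed

text \<open>Rectangles are an intersection-stable generator, and since \<open>M\<close> is finite
  the whole space, repeated, serves as the exhausting sequence.\<close>

lemma measure_eqI_Times:
  assumes "finite_measure M"
    and sM: "sets M = sets (A \<Otimes>\<^sub>M B)" and sN: "sets N = sets (A \<Otimes>\<^sub>M B)"
    and eq: "\<And>X Y. X \<in> sets A \<Longrightarrow> Y \<in> sets B \<Longrightarrow> emeasure M (X \<times> Y) = emeasure N (X \<times> Y)"
  shows "M = N"
proof -
  interpret finite_measure M by fact
  let ?E = "{a \<times> b |a b. a \<in> sets A \<and> b \<in> sets B}"
  show ?thesis
  proof (rule measure_eqI_generator_eq[OF Int_stable_pair_measure_generator[of A B],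
        where A = "\<lambda>_. space A \<times> space B"])
    show "?E \<subseteq> Pow (space A \<times> space B)"
      using sets.space_closed[of A] sets.space_closed[of B] by auto
    show "emeasure M (space A \<times> space B) \<noteq> \<infinity>"
      by simp
  qed (auto simp: sM sN sets_pair_measure eq)
qed

text \<open>The measure \<open>\<omega>(dy) K(y, dx)\<close>, the law of a start and one move. In
  this form reversibility is the symmetry of a measure.\<close>

definition joint_law ::
  "'a::topological_space measure \<Rightarrow> ('a \<Rightarrow> 'b::topological_space measure) \<Rightarrow> ('a \<times> 'b) measure" where
  "joint_law \<omega> K = \<omega> \<bind> (\<lambda>y. distr (K y) (borel \<Otimes>\<^sub>M borel) (Pair y))"

lemma markov_kernel_prob_algebra:
  "markov_kernel K \<Longrightarrow> K \<in> borel \<rightarrow>\<^sub>M prob_algebra borel"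
  by (simp add: markov_kernel_def)

lemma markov_kernel_subprob_algebra:
  "markov_kernel K \<Longrightarrow> K \<in> borel \<rightarrow>\<^sub>M subprob_algebra borel"
  by (simp add: markov_kernel_def measurable_prob_algebraD)

lemma
  assumes "markov_kernel K"
  shows sets_markov_kernel: "sets (K y) = sets borel"
    and prob_space_markov_kernel: "prob_space (K y)"
  using measurable_space[OF markov_kernel_prob_algebra[OF assms], of y]
  by (auto simp: space_prob_algebra)

lemma joint_kernel_measurable:
  assumes "markov_kernel K"
  shows "(\<lambda>y. distr (K y) (borel \<Otimes>\<^sub>M borel) (Pair y)) \<in> borel \<rightarrow>\<^sub>M prob_algebra (borel \<Otimes>\<^sub>M borel)"
  using markov_kernel_prob_algebra[OF assms] by measurable

text \<open>Source and target may differ, so the locale covers conditional distributions as well as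
  transition kernels.\<close>

locale markov_pair = prob_space \<omega>
  for \<omega> :: "'a::topological_space measure" +
  fixes K :: "'a \<Rightarrow> 'b::topological_space measure"
  assumes sets_base [measurable_cong, simp]: "sets \<omega> = sets borel"
    and markov: "markov_kernel K"
begin

lemma space_base [simp]: "space \<omega> = UNIV"
  using sets_eq_imp_space_eq[OF sets_base] by simp

lemma kernel_prob [measurable]: "K \<in> borel \<rightarrow>\<^sub>M prob_algebra borel"
  by (rule markov_kernel_prob_algebra[OF markov])

lemma kernel_subprob [measurable]: "K \<in> borel \<rightarrow>\<^sub>M subprob_algebra borel"
  by (rule markov_kernel_subprob_algebra[OF markov])

lemma sets_kernel_borel [measurable_cong, simp]: "sets (K y) = sets borel"
  by (rule sets_markov_kernel[OF markov])

lemma space_kernel_UNIV [simp]: "space (K y) = UNIV"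
  using sets_eq_imp_space_eq[OF sets_kernel_borel, of y] by simp

lemma prob_space_kernel: "prob_space (K y)"
  by (rule prob_space_markov_kernel[OF markov])

lemma base_in_prob_algebra: "\<omega> \<in> space (prob_algebra borel)"
  by (simp add: space_prob_algebra prob_space_axioms)

lemma joint_kernel_subprob:
  "(\<lambda>y. distr (K y) (borel \<Otimes>\<^sub>M borel) (Pair y)) \<in> \<omega> \<rightarrow>\<^sub>M subprob_algebra (borel \<Otimes>\<^sub>M borel)"
  using measurable_prob_algebraD[OF joint_kernel_measurable[OF markov]] by simp

lemma sets_joint [measurable_cong, simp]: "sets (joint_law \<omega> K) = sets (borel \<Otimes>\<^sub>M borel)"
  unfolding joint_law_def by (subst sets_bind) auto

lemma space_joint [simp]: "space (joint_law \<omega> K) = UNIV"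
  using sets_eq_imp_space_eq[OF sets_joint] by (simp add: space_pair_measure)

lemma prob_space_joint: "prob_space (joint_law \<omega> K)"
  unfolding joint_law_def
  by (rule prob_space_bind'[OF base_in_prob_algebra joint_kernel_measurable[OF markov]])

lemma nn_integral_joint:
  assumes [measurable]: "h \<in> borel_measurable (borel \<Otimes>\<^sub>M borel)"
  shows "(\<integral>\<^sup>+w. h w \<partial>joint_law \<omega> K) = (\<integral>\<^sup>+y. (\<integral>\<^sup>+x. h (y, x) \<partial>K y) \<partial>\<omega>)"
  unfolding joint_law_def
  by (subst nn_integral_bind[OF assms joint_kernel_subprob])
     (auto intro!: nn_integral_cong simp: nn_integral_distr)

lemma emeasure_joint_Times:
  assumes [measurable]: "A \<in> sets borel" "B \<in> sets borel"
  shows "emeasure (joint_law \<omega> K) (A \<times> B) = (\<integral>\<^sup>+ y \<in> A. emeasure (K y) B \<partial>\<omega>)"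
proof -
  have "emeasure (joint_law \<omega> K) (A \<times> B) = (\<integral>\<^sup>+w. indicator (A \<times> B) w \<partial>joint_law \<omega> K)"
    by simp
  also have "\<dots> = (\<integral>\<^sup>+y. (\<integral>\<^sup>+x. indicator B x * indicator A y \<partial>K y) \<partial>\<omega>)"
    by (subst nn_integral_joint) (auto intro!: nn_integral_cong split: split_indicator)
  also have "\<dots> = (\<integral>\<^sup>+ y \<in> A. emeasure (K y) B \<partial>\<omega>)"
    by (intro nn_integral_cong) (simp add: nn_integral_multc)
  finally show ?thesis .
qed

lemma measurable_Pair_kernel: "Pair a \<in> K b \<rightarrow>\<^sub>M borel \<Otimes>\<^sub>M borel" for a :: 'a
  by measurable

lemma integral_joint:
  fixes h :: "'a \<times> 'b \<Rightarrow> real"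
  assumes h [measurable]: "h \<in> borel_measurable (borel \<Otimes>\<^sub>M borel)"
    and int: "integrable (joint_law \<omega> K) h"
  shows "(\<integral>w. h w \<partial>joint_law \<omega> K) = (\<integral>y. (\<integral>x. h (y, x) \<partial>K y) \<partial>\<omega>)"
proof -
  have "(\<integral>w. h w \<partial>distr (K y) (borel \<Otimes>\<^sub>M borel) (Pair y)) = (\<integral>x. h (y, x) \<partial>K y)" for y
    by (rule integral_distr[OF measurable_Pair_kernel h])
  then show ?thesis
    using integral_bind_eq[OF joint_kernel_subprob h int[unfolded joint_law_def]]
    by (simp add: joint_law_def)
qed

end


section \<open>Reversible kernels on square-integrable functions\<close>

text \<open>No mean-zero condition, because constants and restrictions of mean-zero functions to a
  fibre have to be handled too.\<close>

definition L2 :: "'a measure \<Rightarrow> ('a \<Rightarrow> real) set" where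
  "L2 \<omega> = {f \<in> borel_measurable \<omega>. integrable \<omega> (\<lambda>x. (f x)\<^sup>2)}"

lemma L2_0_subset_L2: "L2_0 \<omega> \<subseteq> L2 \<omega>"
  by (auto simp: L2_0_def L2_def)

lemma L2_measurable: "f \<in> L2 \<omega> \<Longrightarrow> f \<in> borel_measurable \<omega>"
  by (simp add: L2_def)

lemma L2_square_integrable: "f \<in> L2 \<omega> \<Longrightarrow> integrable \<omega> (\<lambda>x. (f x)\<^sup>2)"
  by (simp add: L2_def)

lemma abs_mult_le_sum_squares: "\<bar>x * y\<bar> \<le> x\<^sup>2 + y\<^sup>2" for x y :: real
  using sum_squares_bound[of "\<bar>x\<bar>" "\<bar>y\<bar>"] mult_nonneg_nonneg[of "\<bar>x\<bar>" "\<bar>y\<bar>"]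
  unfolding abs_mult power2_abs by linarith

lemma L2_mult_integrable:
  assumes "f \<in> L2 \<omega>" "g \<in> L2 \<omega>"
  shows "integrable \<omega> (\<lambda>x. f x * g x)"
proof (rule Bochner_Integration.integrable_bound)
  show "integrable \<omega> (\<lambda>x. (f x)\<^sup>2 + (g x)\<^sup>2)"
    using assms by (auto simp: L2_def)
  show "AE x in \<omega>. norm (f x * g x) \<le> norm ((f x)\<^sup>2 + (g x)\<^sup>2)"
    by (rule AE_I2) (simp add: abs_mult_le_sum_squares)
qed (use assms in \<open>auto simp: L2_def\<close>)

lemma L2_lincomb:
  assumes "f \<in> L2 \<omega>" "g \<in> L2 \<omega>"
  shows "(\<lambda>x. a * f x + b * g x) \<in> L2 \<omega>"
proof -
  have "integrable \<omega> (\<lambda>x. a\<^sup>2 * (f x)\<^sup>2 + 2 * a * b * (f x * g x) + b\<^sup>2 * (g x)\<^sup>2)"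
    using assms L2_mult_integrable[OF assms] by (auto simp: L2_def)
  also have "(\<lambda>x. a\<^sup>2 * (f x)\<^sup>2 + 2 * a * b * (f x * g x) + b\<^sup>2 * (g x)\<^sup>2) = (\<lambda>x. (a * f x + b * g x)\<^sup>2)"
    by (auto simp: power2_eq_square algebra_simps)
  finally show ?thesis
    using assms by (auto simp: L2_def)
qed

section \<open>The inner product and the Cauchy-Schwarz inequality\<close>

lemma L2_inner_commute: "L2_inner \<omega> f g = L2_inner \<omega> g f"
  by (simp add: L2_inner_def mult.commute)

lemma L2_inner_lincomb_left:
  assumes "f \<in> L2 \<omega>" "g \<in> L2 \<omega>" "h \<in> L2 \<omega>"
  shows "L2_inner \<omega> (\<lambda>x. a * f x + b * g x) h = a * L2_inner \<omega> f h + b * L2_inner \<omega> g h"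
proof -
  have "L2_inner \<omega> (\<lambda>x. a * f x + b * g x) h = (\<integral>x. a * (f x * h x) + b * (g x * h x) \<partial>\<omega>)"
    by (simp add: L2_inner_def algebra_simps)
  also have "\<dots> = a * L2_inner \<omega> f h + b * L2_inner \<omega> g h"
    using L2_mult_integrable[OF assms(1,3)] L2_mult_integrable[OF assms(2,3)]
    by (simp add: L2_inner_def)
  finally show ?thesis .
qed

lemma L2_inner_lincomb_right:
  assumes "f \<in> L2 \<omega>" "g \<in> L2 \<omega>" "h \<in> L2 \<omega>"
  shows "L2_inner \<omega> h (\<lambda>x. a * f x + b * g x) = a * L2_inner \<omega> h f + b * L2_inner \<omega> h g"
  using L2_inner_lincomb_left[OF assms] by (simp add: L2_inner_commute)

lemma L2_inner_self_nonneg: "0 \<le> L2_inner \<omega> f f"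
  by (simp add: L2_inner_def)

lemma L2_norm_square: "(L2_norm \<omega> f)\<^sup>2 = L2_inner \<omega> f f"
  by (simp add: L2_norm_def L2_inner_self_nonneg)

lemma L2_norm_nonneg: "0 \<le> L2_norm \<omega> f"
  by (simp add: L2_norm_def L2_inner_self_nonneg)

text \<open>The squared norm of \<open>a f + b g\<close> is a nonnegative quadratic form in
  \<open>a\<close> and \<open>b\<close>.\<close>

lemma L2_inner_abs_le:
  assumes "f \<in> L2 \<omega>" "g \<in> L2 \<omega>"
  shows "\<bar>L2_inner \<omega> f g\<bar> \<le> L2_norm \<omega> f * L2_norm \<omega> g"
proof -
  let ?ff = "L2_inner \<omega> f f" and ?fg = "L2_inner \<omega> f g" and ?gg = "L2_inner \<omega> g g"
  have quad: "0 \<le> a\<^sup>2 * ?ff + 2 * a * b * ?fg + b\<^sup>2 * ?gg" for a b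
  proof -
    let ?h = "\<lambda>x. a * f x + b * g x"
    have "0 \<le> L2_inner \<omega> ?h ?h"
      by (rule L2_inner_self_nonneg)
    also have "\<dots> = a * (a * ?ff + b * ?fg) + b * (a * ?fg + b * ?gg)"
      using assms L2_lincomb[OF assms]
      by (simp add: L2_inner_lincomb_left L2_inner_lincomb_right L2_inner_commute[of _ g f])
    finally show ?thesis
      by (simp add: algebra_simps power2_eq_square)
  qed
  have "?fg\<^sup>2 \<le> ?ff * ?gg"
  proof (cases "?ff = 0")
    case True
    have "?fg = 0"
    proof (rule ccontr)
      assume "?fg \<noteq> 0"
      \<comment> \<open>With \<open>?ff = 0\<close> the form is linear in \<open>a\<close>; at this
        \<open>a\<close> and \<open>b = 1\<close> its value is -1.\<close>
      then show False
        using quad[of "- (?gg + 1) / (2 * ?fg)" 1] True by (simp add: field_simps)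
    qed
    then show ?thesis
      using True by simp
  next
    case False
    then have pos: "?ff > 0"
      using L2_inner_self_nonneg[of \<omega> f] by simp
    have "0 \<le> ?ff * (?ff * ?gg - ?fg\<^sup>2)"
      using quad[of "- ?fg" ?ff] by (simp add: algebra_simps power2_eq_square)
    then show ?thesis
      using pos by (simp add: zero_le_mult_iff)
  qed
  then have "sqrt (?fg\<^sup>2) \<le> sqrt (?ff * ?gg)"
    by (rule real_sqrt_le_mono)
  then show ?thesis
    by (simp add: L2_norm_def real_sqrt_mult)
qed

context prob_space
begin

lemma L2_integrable:
  assumes "f \<in> L2 M"
  shows "integrable M f"
  by (rule square_integrable_imp_integrable[OF L2_measurable L2_square_integrable]; fact)

lemma L2_const: "(\<lambda>_. c) \<in> L2 M"
  by (simp add: L2_def)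

lemma L2_minus_mean:
  assumes "f \<in> L2 M"
  shows "(\<lambda>x. f x - expectation f) \<in> L2_0 M"
proof -
  have "(\<lambda>x. f x - expectation f) \<in> L2 M"
    using L2_lincomb[OF assms L2_const[of "expectation f"], of 1 "- 1"] by simp
  moreover have "expectation (\<lambda>x. f x - expectation f) = 0"
    using L2_integrable[OF assms] by (simp add: prob_space)
  ultimately show ?thesis
    by (simp add: L2_0_def L2_def)
qed

text \<open>Jensen for the square, read off from a nonnegative variance.\<close>

lemma square_expectation_le:
  assumes "integrable M f" "integrable M (\<lambda>x. (f x)\<^sup>2)"
  shows "(expectation f)\<^sup>2 \<le> expectation (\<lambda>x. (f x :: real)\<^sup>2)"
  using variance_positive[of f] variance_eq[OF assms] by simp

end

lemma L2_0_lincomb: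
  assumes "prob_space \<omega>" "f \<in> L2_0 \<omega>" "g \<in> L2_0 \<omega>"
  shows "(\<lambda>x. a * f x + b * g x) \<in> L2_0 \<omega>"
proof -
  interpret prob_space \<omega> by fact
  have fg: "f \<in> L2 \<omega>" "g \<in> L2 \<omega>"
    using assms L2_0_subset_L2 by auto
  show ?thesis
    using L2_lincomb[OF fg, of a b] L2_integrable[OF fg(1)] L2_integrable[OF fg(2)] assms(2,3)
    by (simp add: L2_0_def L2_def)
qed

locale reversible_kernel = markov_pair \<omega> K
  for \<omega> :: "'a::topological_space measure" and K :: "'a \<Rightarrow> 'a measure" +
  assumes reversible: "reversible \<omega> K"
begin

lemma L2_borel_measurable: "f \<in> L2 \<omega> \<Longrightarrow> f \<in> borel_measurable borel"
  using L2_measurable[of f \<omega>] by simp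

text \<open>Reversibility states this symmetry on rectangles, which determine the measure.\<close>

lemma joint_symmetric:
  "distr (joint_law \<omega> K) (borel \<Otimes>\<^sub>M borel) (\<lambda>(y, x). (x, y)) = joint_law \<omega> K" (is "?J' = ?J")
proof -
  interpret J: prob_space ?J
    by (rule prob_space_joint)
  have [measurable]: "(\<lambda>(y, x). (x, y)) \<in> ?J \<rightarrow>\<^sub>M borel \<Otimes>\<^sub>M (borel :: 'a measure)"
    by measurable
  show ?thesis
  proof (rule measure_eqI_Times[symmetric])
    show "finite_measure ?J"
      by (rule J.finite_measure_axioms)
    fix A B :: "'a set" assume [measurable]: "A \<in> sets borel" "B \<in> sets borel"
    have "emeasure ?J' (A \<times> B) = emeasure ?J (B \<times> A)"
      by (subst emeasure_distr) (auto intro!: arg_cong[where f = "emeasure ?J"])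
    also have "\<dots> = emeasure ?J (A \<times> B)"
      using reversible by (simp add: emeasure_joint_Times reversible_def)
    finally show "emeasure ?J (A \<times> B) = emeasure ?J' (A \<times> B)" ..
  qed simp_all
qed

text \<open>Integrate \<open>h\<close> of the second coordinate under the joint law and swap: by
  symmetry both coordinates have law \<omega>.\<close>

lemma nn_integral_stationary:
  assumes [measurable]: "h \<in> borel_measurable borel"
  shows "(\<integral>\<^sup>+y. (\<integral>\<^sup>+x. h x \<partial>K y) \<partial>\<omega>) = (\<integral>\<^sup>+y. h y \<partial>\<omega>)"
proof -
  have [measurable]: "(\<lambda>(y, x). (x, y)) \<in> joint_law \<omega> K \<rightarrow>\<^sub>M borel \<Otimes>\<^sub>M (borel :: 'a measure)"
    by measurable
  have "(\<integral>\<^sup>+y. (\<integral>\<^sup>+x. h x \<partial>K y) \<partial>\<omega>) = (\<integral>\<^sup>+w. h (snd w) \<partial>joint_law \<omega> K)"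
    by (subst nn_integral_joint) auto
  also have "\<dots> = (\<integral>\<^sup>+w. h (fst w) \<partial>joint_law \<omega> K)"
    by (subst joint_symmetric[symmetric], subst nn_integral_distr) (auto simp: case_prod_beta)
  also have "\<dots> = (\<integral>\<^sup>+y. (\<integral>\<^sup>+x. h y \<partial>K y) \<partial>\<omega>)"
    by (subst nn_integral_joint) auto
  also have "\<dots> = (\<integral>\<^sup>+y. h y \<partial>\<omega>)"
    using prob_space.emeasure_space_1[OF prob_space_kernel] by simp
  finally show ?thesis .
qed

text \<open>Stationarity as an identity of measures, which lets the integral formulas for mixtures
  be applied to \<omega>.\<close>

lemma base_bind: "\<omega> \<bind> K = \<omega>"
proof (rule measure_eqI)
  fix A assume "A \<in> sets (\<omega> \<bind> K)"
  then have [measurable]: "A \<in> sets borel"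
    by (subst (asm) sets_bind) auto
  show "emeasure (\<omega> \<bind> K) A = emeasure \<omega> A"
    using nn_integral_stationary[of "indicator A"]
    by (subst emeasure_bind[of _ _ borel]) auto
qed (subst sets_bind, auto)

lemma
  assumes g: "integrable \<omega> g"
  shows AE_integrable_kernel: "AE y in \<omega>. integrable (K y) g"
    and integrable_kernel_op: "integrable \<omega> (kernel_op K g)"
    and integral_kernel_op: "(\<integral>y. kernel_op K g y \<partial>\<omega>) = (\<integral>y. g y \<partial>\<omega>)"
proof -
  have K: "K \<in> \<omega> \<rightarrow>\<^sub>M subprob_algebra borel"
    by measurable
  have m: "g \<in> borel_measurable borel"
    using borel_measurable_integrable[OF g] by simp
  have g': "integrable (\<omega> \<bind> K) g"
    using g by (simp add: base_bind)
  show "AE y in \<omega>. integrable (K y) g"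
    by (rule AE_integrable_bind[OF K m g'])
  show "integrable \<omega> (kernel_op K g)"
    using integrable_integral_bind[OF K m g'] by (simp add: kernel_op_def[abs_def])
  show "(\<integral>y. kernel_op K g y \<partial>\<omega>) = (\<integral>y. g y \<partial>\<omega>)"
    using integral_bind_eq[OF K m g'] by (simp add: kernel_op_def base_bind)
qed

lemma AE_L2_kernel:
  assumes "g \<in> L2 \<omega>"
  shows "AE y in \<omega>. g \<in> L2 (K y)"
  using AE_integrable_kernel[OF L2_square_integrable[OF assms]] L2_borel_measurable[OF assms]
  by (auto simp: L2_def)

lemma kernel_op_measurable:
  "g \<in> borel_measurable borel \<Longrightarrow> kernel_op K g \<in> borel_measurable borel"
  unfolding kernel_op_def[abs_def]
  by (rule measurable_compose[OF kernel_subprob integral_measurable_subprob_algebra])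

text \<open>Jensen under each \<open>K y\<close>, followed by integration with stationarity.\<close>

lemma kernel_op_L2:
  assumes g: "g \<in> L2 \<omega>"
  shows "kernel_op K g \<in> L2 \<omega>" and kernel_op_norm_le: "L2_norm \<omega> (kernel_op K g) \<le> L2_norm \<omega> g"
proof -
  have le: "AE y in \<omega>. (kernel_op K g y)\<^sup>2 \<le> kernel_op K (\<lambda>x. (g x)\<^sup>2) y"
    using AE_L2_kernel[OF g]
  proof eventually_elim
    case (elim y)
    interpret Ky: prob_space "K y"
      by (rule prob_space_kernel)
    show ?case
      unfolding kernel_op_def
      by (rule Ky.square_expectation_le[OF Ky.L2_integrable[OF elim] L2_square_integrable[OF elim]])
  qed
  have m: "kernel_op K g \<in> borel_measurable \<omega>"
    using kernel_op_measurable[OF L2_borel_measurable[OF g]] by simp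
  have int: "integrable \<omega> (kernel_op K (\<lambda>x. (g x)\<^sup>2))"
    by (rule integrable_kernel_op[OF L2_square_integrable[OF g]])
  have int2: "integrable \<omega> (\<lambda>y. (kernel_op K g y)\<^sup>2)"
    by (rule Bochner_Integration.integrable_bound[OF int]) (use m le in auto)
  then show "kernel_op K g \<in> L2 \<omega>"
    using m by (simp add: L2_def)
  have "(\<integral>y. (kernel_op K g y)\<^sup>2 \<partial>\<omega>) \<le> (\<integral>y. (g y)\<^sup>2 \<partial>\<omega>)"
    using integral_mono_AE[OF int2 int le] integral_kernel_op[OF L2_square_integrable[OF g]] by simp
  then show "L2_norm \<omega> (kernel_op K g) \<le> L2_norm \<omega> g"
    by (simp add: L2_norm_def L2_inner_def power2_eq_square)
qed

lemma kernel_op_L2_0: "g \<in> L2_0 \<omega> \<Longrightarrow> kernel_op K g \<in> L2_0 \<omega>"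
proof -
  assume g: "g \<in> L2_0 \<omega>"
  then have gL: "g \<in> L2 \<omega>"
    using L2_0_subset_L2 by auto
  show ?thesis
    using kernel_op_L2(1)[OF gL] integral_kernel_op[OF L2_integrable[OF gL]] g
    by (simp add: L2_0_def L2_def)
qed

text \<open>Both marginals of the joint law are \<omega>, so \<open>f^2 + g^2\<close> is an
  integrable majorant. The bilinear form becomes an integral against one measure, where symmetry can
  be used.\<close>

lemma
  assumes f: "f \<in> L2 \<omega>" and g: "g \<in> L2 \<omega>"
  shows integrable_joint_mult: "integrable (joint_law \<omega> K) (\<lambda>w. f (fst w) * g (snd w))"
    and inner_kernel_op_joint: "L2_inner \<omega> f (kernel_op K g) = (\<integral>w. f (fst w) * g (snd w) \<partial>joint_law \<omega> K)"
proof -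
  note [measurable] = L2_borel_measurable[OF f] L2_borel_measurable[OF g]
  have fin: "(\<integral>\<^sup>+y. ennreal ((h y)\<^sup>2) \<partial>\<omega>) < \<infinity>" if "h \<in> L2 \<omega>" for h
    using L2_square_integrable[OF that] by (simp add: integrable_iff_bounded)
  have "(\<integral>\<^sup>+w. ennreal \<bar>f (fst w) * g (snd w)\<bar> \<partial>joint_law \<omega> K)
      \<le> (\<integral>\<^sup>+w. ennreal ((f (fst w))\<^sup>2) + ennreal ((g (snd w))\<^sup>2) \<partial>joint_law \<omega> K)"
  proof (intro nn_integral_mono)
    fix w :: "'a \<times> 'a"
    show "ennreal \<bar>f (fst w) * g (snd w)\<bar> \<le> ennreal ((f (fst w))\<^sup>2) + ennreal ((g (snd w))\<^sup>2)"
      using abs_mult_le_sum_squares[of "f (fst w)" "g (snd w)"]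
      by (simp add: ennreal_plus[symmetric] del: ennreal_plus)
  qed
  also have "\<dots> = (\<integral>\<^sup>+y. ennreal ((f y)\<^sup>2) \<partial>\<omega>) + (\<integral>\<^sup>+y. ennreal ((g y)\<^sup>2) \<partial>\<omega>)"
    using prob_space.emeasure_space_1[OF prob_space_kernel]
    by (subst nn_integral_add) (auto simp: nn_integral_joint nn_integral_stationary)
  also have "\<dots> < \<infinity>"
    using fin[OF f] fin[OF g] by simp
  finally show int: "integrable (joint_law \<omega> K) (\<lambda>w. f (fst w) * g (snd w))"
    by (intro integrableI_bounded) auto
  show "L2_inner \<omega> f (kernel_op K g) = (\<integral>w. f (fst w) * g (snd w) \<partial>joint_law \<omega> K)"
    by (subst integral_joint[OF _ int]) (auto simp: L2_inner_def kernel_op_def)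
qed

text \<open>Swapping the coordinates of the symmetric joint law exchanges \<open>f\<close> and
  \<open>g\<close>.\<close>

lemma kernel_op_self_adjoint:
  assumes f: "f \<in> L2 \<omega>" and g: "g \<in> L2 \<omega>"
  shows "L2_inner \<omega> f (kernel_op K g) = L2_inner \<omega> g (kernel_op K f)"
proof -
  note [measurable] = L2_borel_measurable[OF f] L2_borel_measurable[OF g]
  have [measurable]: "(\<lambda>(y, x). (x, y)) \<in> joint_law \<omega> K \<rightarrow>\<^sub>M borel \<Otimes>\<^sub>M (borel :: 'a measure)"
    by measurable
  have "L2_inner \<omega> f (kernel_op K g) = (\<integral>w. f (fst w) * g (snd w) \<partial>joint_law \<omega> K)"
    by (rule inner_kernel_op_joint[OF f g])
  also have "\<dots> = (\<integral>w. g (fst w) * f (snd w) \<partial>joint_law \<omega> K)"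
    by (subst joint_symmetric[symmetric], subst integral_distr) (auto simp: case_prod_beta mult.commute)
  also have "\<dots> = L2_inner \<omega> g (kernel_op K f)"
    by (rule inner_kernel_op_joint[OF g f, symmetric])
  finally show ?thesis .
qed

text \<open>Pointwise, \<open>kernel_op K\<close> is additive only where both functions are
  integrable for \<open>K y\<close>. Moving the operator onto \<open>h\<close> by self-adjointness
  avoids the exceptional null set.\<close>

lemma inner_kernel_op_lincomb_right:
  assumes "f \<in> L2 \<omega>" "g \<in> L2 \<omega>" "h \<in> L2 \<omega>"
  shows "L2_inner \<omega> h (kernel_op K (\<lambda>x. a * f x + b * g x))
    = a * L2_inner \<omega> h (kernel_op K f) + b * L2_inner \<omega> h (kernel_op K g)"
  unfolding kernel_op_self_adjoint[OF assms(3) L2_lincomb[OF assms(1,2)]]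
    kernel_op_self_adjoint[OF assms(3,1)] kernel_op_self_adjoint[OF assms(3,2)]
  by (rule L2_inner_lincomb_left[OF assms(1,2) kernel_op_L2(1)[OF assms(3)]])

section \<open>The operator norm on mean-zero functions\<close>

lemma bdd_above_kernel_norm:
  "bdd_above ((\<lambda>f. L2_norm \<omega> (kernel_op K f)) ` {f \<in> L2_0 \<omega>. L2_norm \<omega> f \<le> 1})"
proof (rule bdd_aboveI2)
  fix f assume "f \<in> {f \<in> L2_0 \<omega>. L2_norm \<omega> f \<le> 1}"
  then show "L2_norm \<omega> (kernel_op K f) \<le> 1"
    using kernel_op_norm_le[of f] L2_0_subset_L2[of \<omega>] by fastforce
qed

lemma kernel_op_norm_le_kernel_norm:
  assumes f: "f \<in> L2_0 \<omega>"
  shows "L2_norm \<omega> (kernel_op K f) \<le> kernel_norm \<omega> K * L2_norm \<omega> f"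
proof (cases "L2_norm \<omega> f = 0")
  case True
  then show ?thesis
    using kernel_op_norm_le[of f] f L2_0_subset_L2[of \<omega>] by auto
next
  case False
  define c where "c = L2_norm \<omega> f"
  have c: "c > 0"
    using False L2_norm_nonneg[of \<omega> f] by (simp add: c_def)
  \<comment> \<open>The zero summand gives the normalised function the shape required by
    \<open>L2_0_lincomb\<close>.\<close>
  let ?g = "\<lambda>x. (1 / c) * f x + 0 * f x"
  have g: "?g \<in> L2_0 \<omega>"
    by (rule L2_0_lincomb[OF prob_space_axioms f f])
  have norm_scale: "L2_norm \<omega> (\<lambda>x. h x / c) = L2_norm \<omega> h / c" for h
    using c by (simp add: L2_norm_def L2_inner_def real_sqrt_divide)
  have "L2_norm \<omega> ?g = 1"
    using c norm_scale[of f] by (simp add: c_def)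
  then have "L2_norm \<omega> (kernel_op K ?g) \<le> kernel_norm \<omega> K"
    unfolding kernel_norm_def using g by (intro cSUP_upper bdd_above_kernel_norm) auto
  moreover have "kernel_op K ?g = (\<lambda>x. kernel_op K f x / c)"
    by (simp add: kernel_op_def fun_eq_iff)
  ultimately have "L2_norm \<omega> (kernel_op K f) / c \<le> kernel_norm \<omega> K"
    by (simp add: norm_scale)
  then show ?thesis
    using c by (simp add: c_def field_simps)
qed

lemma kernel_norm_nonneg: "0 \<le> kernel_norm \<omega> K"
proof -
  have "(\<lambda>_. 0) \<in> {f \<in> L2_0 \<omega>. L2_norm \<omega> f \<le> 1}"
    by (simp add: L2_0_def L2_norm_def L2_inner_def)
  then have "L2_norm \<omega> (kernel_op K (\<lambda>_. 0)) \<le> kernel_norm \<omega> K"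
    unfolding kernel_norm_def by (rule cSUP_upper[OF _ bdd_above_kernel_norm])
  then show ?thesis
    using L2_norm_nonneg order_trans by blast
qed

lemma inner_kernel_op_le:
  assumes f: "f \<in> L2_0 \<omega>"
  shows "\<bar>L2_inner \<omega> f (kernel_op K f)\<bar> \<le> kernel_norm \<omega> K * L2_inner \<omega> f f"
proof -
  have fL: "f \<in> L2 \<omega>"
    using f L2_0_subset_L2 by auto
  have "\<bar>L2_inner \<omega> f (kernel_op K f)\<bar> \<le> L2_norm \<omega> f * L2_norm \<omega> (kernel_op K f)"
    by (rule L2_inner_abs_le[OF fL kernel_op_L2(1)[OF fL]])
  also have "\<dots> \<le> L2_norm \<omega> f * (kernel_norm \<omega> K * L2_norm \<omega> f)"
    by (rule mult_left_mono[OF kernel_op_norm_le_kernel_norm[OF f] L2_norm_nonneg])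
  also have "\<dots> = kernel_norm \<omega> K * L2_inner \<omega> f f"
    by (simp add: L2_norm_square[symmetric] power2_eq_square)
  finally show ?thesis .
qed

end


section \<open>Asymptotic variance of a stationary reversible chain\<close>

text \<open>Serves to identify the marginal of the path law on an initial segment with the finite
  iterate \<open>IT.C\<close>.\<close>

lemma (in Ionescu_Tulcea) up_to_atLeastLessThan [simp]: "up_to {0..<n} = n"
  unfolding up_to_def
  by (rule Least_equality) (auto simp: not_less_eq_eq[symmetric] intro: ccontr)

context reversible_kernel
begin

lemma Ionescu_Tulcea_chain: "Ionescu_Tulcea (chain_step \<omega> K) (\<lambda>_. borel)"
  by (rule Ionescu_Tulcea_chain_step[OF prob_space_axioms sets_base markov])

sublocale IT: Ionescu_Tulcea "chain_step \<omega> K" "\<lambda>_. borel"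
  by (rule Ionescu_Tulcea_chain)

section \<open>Finite-dimensional marginals of the path law\<close>

lemma sets_chain_law [measurable_cong, simp]: "sets (chain_law \<omega> K) = sets (PiM UNIV (\<lambda>_. borel))"
  unfolding chain_law_def by (rule IT.PF.sets_lim)

lemma restrict_chain_measurable:
  "(\<lambda>x. restrict x {0..<n}) \<in> chain_law \<omega> K \<rightarrow>\<^sub>M PiM {0..<n} (\<lambda>_. borel)"
  by (intro measurable_restrict) auto

lemma distr_chain_law:
  "distr (chain_law \<omega> K) (PiM {0..<n} (\<lambda>_. borel)) (\<lambda>x. restrict x {0..<n}) = IT.C 0 n (\<lambda>_. undefined)"
proof -
  have "distr (chain_law \<omega> K) (PiM {0..<n} (\<lambda>_. borel)) (\<lambda>x. restrict x {0..<n}) = IT.CI {0..<n}"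
    unfolding chain_law_def by (rule IT.distr_lim) simp
  also have "\<dots> = IT.C 0 n (\<lambda>_. undefined)"
    using IT.distr_C[of n n "\<lambda>_. undefined" 0] by (simp add: IT.CI_def)
  finally show ?thesis .
qed

text \<open>Total mass can be read off any image measure; the projection to no coordinates at all
  suffices.\<close>

lemma prob_space_chain_law: "prob_space (chain_law \<omega> K)"
proof (rule prob_space_distrD)
  show "(\<lambda>x. restrict x {0..<0}) \<in> chain_law \<omega> K \<rightarrow>\<^sub>M PiM {0..<0} (\<lambda>_. borel)"
    by (rule restrict_chain_measurable)
  show "prob_space (distr (chain_law \<omega> K) (PiM {0..<0} (\<lambda>_. borel)) (\<lambda>x. restrict x {0..<0}))"
    unfolding distr_chain_law by (rule IT.prob_space_C) simp
qed

lemma chain_component_measurable [measurable]: "(\<lambda>x. x i) \<in> chain_law \<omega> K \<rightarrow>\<^sub>M borel"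
  by measurable

lemma nn_integral_chain_law:
  assumes "\<phi> \<in> borel_measurable (PiM {0..<n} (\<lambda>_. borel))"
  shows "(\<integral>\<^sup>+x. \<phi> (restrict x {0..<n}) \<partial>chain_law \<omega> K) = (\<integral>\<^sup>+x. \<phi> x \<partial>IT.C 0 n (\<lambda>_. undefined))"
  unfolding distr_chain_law[symmetric]
  by (rule nn_integral_distr[OF restrict_chain_measurable, symmetric]) (simp add: assms)

text \<open>The law of \<open>Suc n\<close> coordinates is the law of \<open>n\<close> coordinates
  followed by one step, so the last coordinate can be integrated out first.\<close>

lemma nn_integral_chain_Suc:
  assumes [measurable]: "\<phi> \<in> borel_measurable (PiM {0..<Suc n} (\<lambda>_. borel))"
  shows "(\<integral>\<^sup>+x. \<phi> (restrict x {0..<Suc n}) \<partial>chain_law \<omega> K)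
    = (\<integral>\<^sup>+x. (\<integral>\<^sup>+b. \<phi> ((restrict x {0..<n})(n := b)) \<partial>chain_step \<omega> K n (restrict x {0..<n})) \<partial>chain_law \<omega> K)"
proof -
  have C: "IT.C 0 n (\<lambda>_. undefined) \<in> space (subprob_algebra (PiM {0..<n} (\<lambda>_. borel)))"
    using IT.measurable_C[THEN measurable_space, of "\<lambda>_. undefined" 0 n] by simp
  have s: "sets (IT.C 0 n (\<lambda>_. undefined)) = sets (PiM {0..<n} (\<lambda>_. borel))"
    using C by (simp add: space_subprob_algebra)
  have eP: "IT.eP n \<in> IT.C 0 n (\<lambda>_. undefined) \<rightarrow>\<^sub>M subprob_algebra (PiM {0..<Suc n} (\<lambda>_. borel))"
    by (subst measurable_cong_sets[OF s refl]) (rule IT.measurable_eP)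
  have "(\<integral>\<^sup>+x. \<phi> (restrict x {0..<Suc n}) \<partial>chain_law \<omega> K)
      = (\<integral>\<^sup>+x. \<phi> x \<partial>(IT.C 0 n (\<lambda>_. undefined) \<bind> IT.eP n))"
    by (subst nn_integral_chain_law) auto
  also have "\<dots> = (\<integral>\<^sup>+x. (\<integral>\<^sup>+y. \<phi> y \<partial>IT.eP n x) \<partial>IT.C 0 n (\<lambda>_. undefined))"
    by (rule nn_integral_bind[OF assms eP])
  also have "\<dots> = (\<integral>\<^sup>+x. (\<integral>\<^sup>+y. \<phi> y \<partial>IT.eP n (restrict x {0..<n})) \<partial>chain_law \<omega> K)"
    by (rule nn_integral_chain_law[symmetric])
       (rule measurable_compose[OF IT.measurable_eP nn_integral_measurable_subprob_algebra[OF assms]])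
  also have "\<dots> = (\<integral>\<^sup>+x. (\<integral>\<^sup>+b. \<phi> ((restrict x {0..<n})(n := b)) \<partial>chain_step \<omega> K n (restrict x {0..<n})) \<partial>chain_law \<omega> K)"
    by (intro nn_integral_cong IT.nn_integral_eP assms) (auto simp: space_PiM)
  finally show ?thesis .
qed

text \<open>The Markov property. Since \<open>i \<le> j\<close>, the value \<open>x i\<close> is
  fixed before the last step, and that step depends on the past through \<open>x j\<close>
  alone.\<close>

lemma nn_integral_chain_step:
  assumes [measurable]: "h \<in> borel_measurable (borel \<Otimes>\<^sub>M borel)" and "i \<le> j"
  shows "(\<integral>\<^sup>+x. h (x i, x (Suc j)) \<partial>chain_law \<omega> K)
    = (\<integral>\<^sup>+x. (\<integral>\<^sup>+b. h (x i, b) \<partial>K (x j)) \<partial>chain_law \<omega> K)"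
proof -
  have [measurable]: "(\<lambda>x. x i) \<in> PiM {0..<Suc (Suc j)} (\<lambda>_. borel) \<rightarrow>\<^sub>M (borel :: 'a measure)"
    "(\<lambda>x. x (Suc j)) \<in> PiM {0..<Suc (Suc j)} (\<lambda>_. borel) \<rightarrow>\<^sub>M (borel :: 'a measure)"
    using \<open>i \<le> j\<close> by (auto intro!: measurable_component_singleton)
  have "(\<lambda>x. h (x i, x (Suc j))) \<in> borel_measurable (PiM {0..<Suc (Suc j)} (\<lambda>_. borel))"
    by measurable
  from nn_integral_chain_Suc[OF this] \<open>i \<le> j\<close> show ?thesis
    by (simp add: chain_step_def)
qed

text \<open>Induction on time: the last step is integrated out and stationarity absorbs it.\<close>

lemma nn_integral_chain_marginal:
  assumes [measurable]: "h \<in> borel_measurable borel"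
  shows "(\<integral>\<^sup>+x. h (x n) \<partial>chain_law \<omega> K) = (\<integral>\<^sup>+y. h y \<partial>\<omega>)"
  using assms
proof (induction n arbitrary: h)
  case 0
  have "(\<lambda>x. x 0) \<in> PiM {0..<Suc 0} (\<lambda>_. borel) \<rightarrow>\<^sub>M (borel :: 'a measure)"
    by (auto intro!: measurable_component_singleton)
  note * = measurable_compose[OF this 0]
  show ?case
    using nn_integral_chain_Suc[OF *] prob_space.emeasure_space_1[OF prob_space_chain_law]
    by (simp add: chain_step_def)
next
  case (Suc n)
  note [measurable] = Suc.prems
  have m: "(\<lambda>y. \<integral>\<^sup>+b. h b \<partial>K y) \<in> borel_measurable borel"
    by (rule measurable_compose[OF kernel_subprob nn_integral_measurable_subprob_algebra[OF Suc.prems]])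
  have "(\<integral>\<^sup>+x. h (x (Suc n)) \<partial>chain_law \<omega> K) = (\<integral>\<^sup>+x. (\<integral>\<^sup>+b. h b \<partial>K (x n)) \<partial>chain_law \<omega> K)"
    using nn_integral_chain_step[of "\<lambda>w. h (snd w)" n n] by simp
  also have "\<dots> = (\<integral>\<^sup>+y. (\<integral>\<^sup>+b. h b \<partial>K y) \<partial>\<omega>)"
    by (rule Suc.IH[OF m])
  also have "\<dots> = (\<integral>\<^sup>+y. h y \<partial>\<omega>)"
    by (rule nn_integral_stationary[OF Suc.prems])
  finally show ?case .
qed

lemma distr_chain_component: "distr (chain_law \<omega> K) borel (\<lambda>x. x n) = \<omega>"
proof (rule measure_eqI)
  fix A assume "A \<in> sets (distr (chain_law \<omega> K) borel (\<lambda>x. x n))"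
  then have [measurable]: "A \<in> sets borel"
    by simp
  have "emeasure (distr (chain_law \<omega> K) borel (\<lambda>x. x n)) A
      = (\<integral>\<^sup>+y. indicator A y \<partial>distr (chain_law \<omega> K) borel (\<lambda>x. x n))"
    by simp
  also have "\<dots> = (\<integral>\<^sup>+x. indicator A (x n) \<partial>chain_law \<omega> K)"
    by (rule nn_integral_distr[OF chain_component_measurable]) simp
  also have "\<dots> = emeasure \<omega> A"
    by (subst nn_integral_chain_marginal) auto
  finally show "emeasure (distr (chain_law \<omega> K) borel (\<lambda>x. x n)) A = emeasure \<omega> A" .
qed simp

lemma chain_L2:
  assumes "f \<in> L2 \<omega>"
  shows "(\<lambda>x. f (x n)) \<in> L2 (chain_law \<omega> K)"
proof -
  note [measurable] = L2_borel_measurable[OF assms]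
  have "integrable (distr (chain_law \<omega> K) borel (\<lambda>x. x n)) (\<lambda>y. (f y)\<^sup>2)"
    unfolding distr_chain_component by (rule L2_square_integrable[OF assms])
  then show ?thesis
    by (subst (asm) integrable_distr_eq) (auto simp: L2_def)
qed

lemma integral_chain_component:
  assumes [measurable]: "f \<in> borel_measurable borel"
  shows "(\<integral>x. f (x n) \<partial>chain_law \<omega> K) = (\<integral>y. f y \<partial>\<omega> :: real)"
proof -
  have "(\<integral>y. f y \<partial>distr (chain_law \<omega> K) borel (\<lambda>x. x n)) = (\<integral>x. f (x n) \<partial>chain_law \<omega> K)"
    by (rule integral_distr[OF chain_component_measurable assms])
  then show ?thesis
    by (simp add: distr_chain_component)
qed

lemma chain_pair_measurable: "(\<lambda>x. (x i, x j)) \<in> chain_law \<omega> K \<rightarrow>\<^sub>M borel \<Otimes>\<^sub>M borel"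
  by (rule measurable_Pair[OF chain_component_measurable chain_component_measurable])

text \<open>The Markov property for a pair of times as an identity of measures, so that
  \<open>integral_bind_eq\<close> can treat signed integrands.\<close>

lemma distr_chain_pair_Suc:
  assumes "i \<le> j"
  shows "distr (chain_law \<omega> K) (borel \<Otimes>\<^sub>M borel) (\<lambda>x. (x i, x (Suc j)))
    = distr (chain_law \<omega> K) (borel \<Otimes>\<^sub>M borel) (\<lambda>x. (x i, x j))
        \<bind> (\<lambda>w. distr (K (snd w)) (borel \<Otimes>\<^sub>M borel) (Pair (fst w)))" 
proof (rule measure_eqI)
  let ?A = "distr (chain_law \<omega> K) (borel \<Otimes>\<^sub>M borel) (\<lambda>x. (x i, x (Suc j)))"
  let ?B = "distr (chain_law \<omega> K) (borel \<Otimes>\<^sub>M borel) (\<lambda>x. (x i, x j))"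
  let ?\<kappa> = "\<lambda>w. distr (K (snd w)) (borel \<Otimes>\<^sub>M borel) (Pair (fst w))"
  have \<kappa>: "?\<kappa> \<in> ?B \<rightarrow>\<^sub>M subprob_algebra (borel \<Otimes>\<^sub>M borel)"
    by (rule measurable_prob_algebraD) measurable
  have ne: "space ?B \<noteq> {}"
    by (simp add: space_pair_measure)
  show "sets ?A = sets (?B \<bind> ?\<kappa>)"
    by (subst sets_bind[OF sets_kernel[OF \<kappa>] ne]) auto
  fix X assume "X \<in> sets ?A"
  then have [measurable]: "X \<in> sets (borel \<Otimes>\<^sub>M borel)"
    by simp
  have "emeasure ?A X = (\<integral>\<^sup>+w. indicator X w \<partial>?A)"
    by simp
  also have "\<dots> = (\<integral>\<^sup>+x. indicator X (x i, x (Suc j)) \<partial>chain_law \<omega> K)"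
    by (rule nn_integral_distr) measurable
  also have "\<dots> = (\<integral>\<^sup>+x. (\<integral>\<^sup>+b. indicator X (x i, b) \<partial>K (x j)) \<partial>chain_law \<omega> K)"
    by (rule nn_integral_chain_step) (use assms in measurable)
  also have "\<dots> = (\<integral>\<^sup>+x. emeasure (?\<kappa> (x i, x j)) X \<partial>chain_law \<omega> K)"
  proof (rule nn_integral_cong)
    fix x
    have "(\<integral>\<^sup>+b. indicator X (x i, b) \<partial>K (x j))
        = (\<integral>\<^sup>+w. indicator X w \<partial>distr (K (x j)) (borel \<Otimes>\<^sub>M borel) (Pair (x i)))"
      by (rule nn_integral_distr[OF measurable_Pair_kernel, symmetric]) simp
    then show "(\<integral>\<^sup>+b. indicator X (x i, b) \<partial>K (x j)) = emeasure (?\<kappa> (x i, x j)) X"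
      by simp
  qed
  also have "\<dots> = (\<integral>\<^sup>+w. emeasure (?\<kappa> w) X \<partial>?B)"
    using measurable_compose[OF \<kappa> measurable_emeasure_subprob_algebra[of X]]
    by (subst nn_integral_distr[OF chain_pair_measurable]) auto
  also have "\<dots> = emeasure (?B \<bind> ?\<kappa>) X"
    by (rule emeasure_bind[OF ne \<kappa>, symmetric]) measurable
  finally show "emeasure ?A X = emeasure (?B \<bind> ?\<kappa>) X" .
qed

section \<open>Autocovariances and the variance of partial sums\<close>

lemma kernel_op_funpow_L2: "f \<in> L2 \<omega> \<Longrightarrow> (kernel_op K ^^ k) f \<in> L2 \<omega>"
  by (induction k) (auto intro: kernel_op_L2(1))

lemma kernel_op_funpow_L2_0: "f \<in> L2_0 \<omega> \<Longrightarrow> (kernel_op K ^^ k) f \<in> L2_0 \<omega>"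
  by (induction k) (auto intro: kernel_op_L2_0)

text \<open>Integrating out the later time replaces \<open>g\<close> by \<open>kernel_op K g\<close>
  and shortens the lag by one; hence the induction runs over all \<open>g\<close>.\<close>

lemma integral_chain_pair:
  assumes f: "f \<in> L2 \<omega>" and g: "g \<in> L2 \<omega>"
  shows "(\<integral>x. f (x i) * g (x (i + k)) \<partial>chain_law \<omega> K) = L2_inner \<omega> f ((kernel_op K ^^ k) g)"
  using g
proof (induction k arbitrary: g)
  case 0
  note [measurable] = L2_borel_measurable[OF f] L2_borel_measurable[OF 0]
  show ?case
    using integral_chain_component[of "\<lambda>y. f y * g y" i] by (simp add: L2_inner_def)
next
  case (Suc k)
  note [measurable] = L2_borel_measurable[OF f] L2_borel_measurable[OF Suc.prems]
    L2_borel_measurable[OF kernel_op_L2(1)[OF Suc.prems]]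
  let ?F = "\<lambda>w. f (fst w) * g (snd w)"
  let ?D = "\<lambda>j. distr (chain_law \<omega> K) (borel \<Otimes>\<^sub>M borel) (\<lambda>x. (x i, x j))"
  let ?\<kappa> = "\<lambda>w. distr (K (snd w)) (borel \<Otimes>\<^sub>M borel) (Pair (fst w))"
  have D: "?D (Suc (i + k)) = ?D (i + k) \<bind> ?\<kappa>"
    by (rule distr_chain_pair_Suc) simp
  have \<kappa>: "?\<kappa> \<in> ?D (i + k) \<rightarrow>\<^sub>M subprob_algebra (borel \<Otimes>\<^sub>M borel)"
    by (rule measurable_prob_algebraD) measurable
  have "integrable (chain_law \<omega> K) (\<lambda>x. f (x i) * g (x (Suc (i + k))))"
    by (rule L2_mult_integrable[OF chain_L2[OF f] chain_L2[OF Suc.prems]])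
  then have int: "integrable (?D (i + k) \<bind> ?\<kappa>) ?F"
    unfolding D[symmetric] by (subst integrable_distr_eq) auto
  have "(\<integral>x. f (x i) * g (x (i + Suc k)) \<partial>chain_law \<omega> K) = (\<integral>w. ?F w \<partial>?D (Suc (i + k)))"
    by (subst integral_distr) auto
  also have "\<dots> = (\<integral>w. (\<integral>v. ?F v \<partial>?\<kappa> w) \<partial>?D (i + k))"
    unfolding D by (rule integral_bind_eq[OF \<kappa> _ int]) measurable
  also have "\<dots> = (\<integral>w. f (fst w) * kernel_op K g (snd w) \<partial>?D (i + k))"
    by (rule Bochner_Integration.integral_cong[OF refl], subst integral_distr[OF measurable_Pair_kernel])
       (auto simp: kernel_op_def)
  also have "\<dots> = (\<integral>x. f (x i) * kernel_op K g (x (i + k)) \<partial>chain_law \<omega> K)"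
    by (subst integral_distr) auto
  also have "\<dots> = L2_inner \<omega> f ((kernel_op K ^^ k) (kernel_op K g))"
    by (rule Suc.IH[OF kernel_op_L2(1)[OF Suc.prems]])
  finally show ?case
    by (simp add: funpow_swap1)
qed

text \<open>The new summand contributes its variance \<open>c 0\<close> and twice its covariances
  \<open>c 1\<close>, ..., \<open>c n\<close> with the earlier ones. A recurrence in
  \<open>n\<close> avoids counting lags in a double sum.\<close>

lemma chain_variance_Suc:
  assumes f: "f \<in> L2_0 \<omega>"
  defines "V \<equiv> \<lambda>n. prob_space.variance (chain_law \<omega> K) (\<lambda>x. \<Sum>s=1..n. f (x s))"
    and "c \<equiv> \<lambda>k. L2_inner \<omega> f ((kernel_op K ^^ k) f)"
  shows "V (Suc n) = V n + (2 * (\<Sum>k<Suc n. c k) - c 0)"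
proof -
  interpret C: prob_space "chain_law \<omega> K"
    by (rule prob_space_chain_law)
  have fL: "f \<in> L2 \<omega>"
    using f L2_0_subset_L2 by auto
  note fx = chain_L2[OF fL]
  note [measurable] = L2_borel_measurable[OF fL]
  have int: "integrable (chain_law \<omega> K) (\<lambda>x. f (x a) * f (x b))" for a b
    by (rule L2_mult_integrable[OF fx fx])
  have sq: "(\<Sum>s=1..n. f (x s))\<^sup>2 = (\<Sum>a=1..n. \<Sum>b=1..n. f (x a) * f (x b))" for x :: "nat \<Rightarrow> 'a" and n
    by (simp add: power2_eq_square sum_product)
  have "C.expectation (\<lambda>x. f (x s)) = 0" for s
    using f by (subst integral_chain_component) (auto simp: L2_0_def)
  then have "C.expectation (\<lambda>x. \<Sum>s=1..n. f (x s)) = 0" for n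
    using C.L2_integrable[OF fx] by (subst Bochner_Integration.integral_sum) auto
  then have V: "V n = C.expectation (\<lambda>x. (\<Sum>s=1..n. f (x s))\<^sup>2)" for n
    by (simp add: V_def)
  have int2: "integrable (chain_law \<omega> K) (\<lambda>x. (\<Sum>s=1..n. f (x s))\<^sup>2)"
    unfolding sq by (intro Bochner_Integration.integrable_sum int)
  have "V (Suc n) = C.expectation (\<lambda>x. (\<Sum>s=1..n. f (x s))\<^sup>2
      + (2 * (\<Sum>s=1..n. f (x s) * f (x (Suc n))) + f (x (Suc n)) * f (x (Suc n))))"
    unfolding V by (rule Bochner_Integration.integral_cong) (auto simp: power2_sum sum_distrib_left sum_distrib_right power2_eq_square algebra_simps)
  also have "\<dots> = V n + (2 * (\<Sum>s=1..n. C.expectation (\<lambda>x. f (x s) * f (x (Suc n))))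
      + C.expectation (\<lambda>x. f (x (Suc n)) * f (x (Suc n))))"
    using int int2 by (simp add: V)
  also have "(\<Sum>s=1..n. C.expectation (\<lambda>x. f (x s) * f (x (Suc n)))) = (\<Sum>s=1..n. c (Suc n - s))"
  proof (rule sum.cong)
    fix s assume "s \<in> {1..n}"
    then show "C.expectation (\<lambda>x. f (x s) * f (x (Suc n))) = c (Suc n - s)"
      using integral_chain_pair[OF fL fL, of s "Suc n - s"] by (simp add: c_def)
  qed simp
  \<comment> \<open>The lag \<open>Suc n - s\<close> runs through 1 to \<open>n\<close> in reverse
    order.\<close>
  also have "\<dots> = (\<Sum>k=1..n. c k)"
    by (rule sum.reindex_bij_witness[of _ "\<lambda>k. Suc n - k" "\<lambda>k. Suc n - k"]) auto
  also have "C.expectation (\<lambda>x. f (x (Suc n)) * f (x (Suc n))) = c 0"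
    using integral_chain_pair[OF fL fL, of "Suc n" 0] by (simp add: c_def)
  also have "(\<Sum>k=1..n. c k) = (\<Sum>k<Suc n. c k) - c 0"
    by (simp add: sum.atLeast1_atMost_eq sum.lessThan_Suc_shift del: sum.lessThan_Suc)
  finally show ?thesis
    by simp
qed

end

text \<open>The increments of \<open>V\<close> converge geometrically to the claimed limit, so their
  deviations are summable and vanish after division by \<open>n\<close>.\<close>

lemma cesaro_geometric:
  fixes c V :: "nat \<Rightarrow> real"
  assumes bound: "\<And>k. \<bar>c k\<bar> \<le> C * r ^ k" and r: "0 \<le> r" "r < 1"
    and V: "\<And>n. V (Suc n) = V n + (2 * (\<Sum>k<Suc n. c k) - c 0)" and V0: "V 0 = 0"
  shows "(\<lambda>n. V n / real n) \<longlonglongrightarrow> 2 * (\<Sum>k. c k) - c 0"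
proof -
  have geo: "summable (\<lambda>k. C * r ^ k)"
    using r by (intro summable_mult summable_geometric) auto
  have sc: "summable c"
    by (rule summable_comparison_test[OF _ geo]) (use bound in auto)
  define L where "L = 2 * (\<Sum>k. c k) - c 0"
  \<comment> \<open>Minus twice the tail of the series: the deviation of the increment from
    \<open>L\<close>.\<close>
  define e where "e n = - 2 * (\<Sum>k. c (k + Suc n))" for n
  have e: "2 * (\<Sum>k<Suc n. c k) - c 0 = L + e n" for n
    using suminf_split_initial_segment[OF sc, of "Suc n"] by (simp add: L_def e_def)
  have e_le: "\<bar>e n\<bar> \<le> 2 * C * r / (1 - r) * r ^ n" for n
  proof -
    have s: "summable (\<lambda>k. C * r ^ Suc n * r ^ k)"
      using r by (intro summable_mult summable_geometric) auto
    have b: "norm (c (k + Suc n)) \<le> C * r ^ Suc n * r ^ k" for k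
      using bound[of "k + Suc n"] by (simp add: power_add mult_ac)
    have "norm (\<Sum>k. c (k + Suc n)) \<le> (\<Sum>k. C * r ^ Suc n * r ^ k)"
      by (rule norm_suminf_le[OF b s])
    also have "\<dots> = C * r ^ Suc n / (1 - r)"
      using r by (subst suminf_mult) (auto simp: suminf_geometric summable_geometric)
    finally have "2 * norm (\<Sum>k. c (k + Suc n)) \<le> 2 * (C * r ^ Suc n / (1 - r))"
      by (rule mult_left_mono) simp
    then show ?thesis
      by (simp add: e_def abs_mult mult_ac)
  qed
  have "summable e"
  proof (rule summable_comparison_test'[where N = 0])
    show "summable (\<lambda>n. 2 * C * r / (1 - r) * r ^ n)"
      using r by (intro summable_mult summable_geometric) auto
  qed (use e_le in simp)
  then have "(\<lambda>n. \<Sum>m<n. e m) \<longlonglongrightarrow> suminf e"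
    by (rule summable_LIMSEQ)
  from tendsto_mult[OF this lim_inverse_n]
  have lim: "(\<lambda>n. (\<Sum>m<n. e m) / real n) \<longlonglongrightarrow> 0"
    by (simp add: divide_inverse)
  have Vn: "V n = real n * L + (\<Sum>m<n. e m)" for n
  proof (induction n)
    case (Suc n)
    have "V (Suc n) = V n + (L + e n)"
      unfolding V e ..
    also have "\<dots> = real (Suc n) * L + (\<Sum>m<Suc n. e m)"
      unfolding Suc.IH by (simp add: algebra_simps)
    finally show ?case .
  qed (simp add: V0)
  have "(\<lambda>n. L + (\<Sum>m<n. e m) / real n) \<longlonglongrightarrow> L + 0"
    by (intro tendsto_intros lim)
  \<comment> \<open>The index 0 has to be excluded: there division by zero gives \<open>L\<close> on
    the left and 0 on the right.\<close>
  moreover have "\<forall>\<^sub>F n in sequentially. L + (\<Sum>m<n. e m) / real n = V n / real n"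
    using eventually_gt_at_top[of 0] by eventually_elim (simp add: Vn field_simps)
  ultimately show ?thesis
    unfolding L_def[symmetric] by (simp add: tendsto_cong)
qed

context reversible_kernel
begin

text \<open>The rate \<open>r\<close> is left free instead of being
  \<open>kernel_norm \<omega> K\<close>, because the rate for the hybrid kernel will be obtained
  from its quadratic form.\<close>

lemma funpow_norm_le:
  assumes contr: "\<And>g. g \<in> L2_0 \<omega> \<Longrightarrow> L2_norm \<omega> (kernel_op K g) \<le> r * L2_norm \<omega> g" and "0 \<le> r"
    and f: "f \<in> L2_0 \<omega>"
  shows "L2_norm \<omega> ((kernel_op K ^^ k) f) \<le> r ^ k * L2_norm \<omega> f"
proof (induction k)
  case (Suc k)
  have "L2_norm \<omega> ((kernel_op K ^^ Suc k) f) \<le> r * L2_norm \<omega> ((kernel_op K ^^ k) f)"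
    using contr[OF kernel_op_funpow_L2_0[OF f]] by simp
  also have "\<dots> \<le> r * (r ^ k * L2_norm \<omega> f)"
    by (rule mult_left_mono[OF Suc.IH \<open>0 \<le> r\<close>])
  finally show ?case
    by (simp add: mult.assoc)
qed simp

lemma inner_funpow_le:
  assumes contr: "\<And>g. g \<in> L2_0 \<omega> \<Longrightarrow> L2_norm \<omega> (kernel_op K g) \<le> r * L2_norm \<omega> g" and "0 \<le> r"
    and f: "f \<in> L2_0 \<omega>" and g: "g \<in> L2 \<omega>"
  shows "\<bar>L2_inner \<omega> g ((kernel_op K ^^ k) f)\<bar> \<le> L2_norm \<omega> g * L2_norm \<omega> f * r ^ k"
proof -
  have "\<bar>L2_inner \<omega> g ((kernel_op K ^^ k) f)\<bar> \<le> L2_norm \<omega> g * L2_norm \<omega> ((kernel_op K ^^ k) f)"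
    using kernel_op_funpow_L2_0[OF f] L2_0_subset_L2[of \<omega>] by (intro L2_inner_abs_le g) auto
  also have "\<dots> \<le> L2_norm \<omega> g * (r ^ k * L2_norm \<omega> f)"
    by (intro mult_left_mono funpow_norm_le[OF contr \<open>0 \<le> r\<close> f] L2_norm_nonneg)
  finally show ?thesis
    by (simp add: mult_ac)
qed

text \<open>The lag-\<open>k\<close> autocovariances are bounded by a multiple of
  \<open>r ^ k\<close>, so the variance recurrence has a Cesaro limit. The series is the Neumann
  expansion of the resolvent form at \<open>f\<close>.\<close>

lemma asymp_var_eq_suminf:
  assumes contr: "\<And>g. g \<in> L2_0 \<omega> \<Longrightarrow> L2_norm \<omega> (kernel_op K g) \<le> r * L2_norm \<omega> g"
    and r: "0 \<le> r" "r < 1" and f: "f \<in> L2_0 \<omega>"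
  shows "asymp_var \<omega> K f = ereal (2 * (\<Sum>k. L2_inner \<omega> f ((kernel_op K ^^ k) f)) - (L2_norm \<omega> f)\<^sup>2)"
proof -
  interpret C: prob_space "chain_law \<omega> K"
    by (rule prob_space_chain_law)
  have fL: "f \<in> L2 \<omega>"
    using f L2_0_subset_L2 by auto
  have V0: "C.variance (\<lambda>x. \<Sum>s=1..0. f (x s)) = 0"
    by simp
  have "(\<lambda>n. C.variance (\<lambda>x. \<Sum>s=1..n. f (x s)) / real n) \<longlonglongrightarrow>
      2 * (\<Sum>k. L2_inner \<omega> f ((kernel_op K ^^ k) f)) - L2_inner \<omega> f ((kernel_op K ^^ 0) f)"
    by (rule cesaro_geometric[OF inner_funpow_le[OF contr r(1) f fL] r chain_variance_Suc[OF f] V0])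
  then show ?thesis
    unfolding asymp_var_def by (intro limI) (simp add: L2_norm_square)
qed

end


section \<open>Comparison of resolvents\<close>

context reversible_kernel
begin

text \<open>For a self-adjoint operator a bound on the quadratic form bounds the norm. The proof
  polarises with \<open>f + b g\<close> and \<open>f - b g\<close>, where \<open>g\<close> is the
  image of \<open>f\<close>, so that the mixed term of the form is the squared norm of
  \<open>g\<close>.\<close>

lemma contraction_of_numerical_range:
  assumes range: "\<And>g. g \<in> L2_0 \<omega> \<Longrightarrow> \<bar>L2_inner \<omega> g (kernel_op K g)\<bar> \<le> r * L2_inner \<omega> g g"
    and r: "r > 0" and f: "f \<in> L2_0 \<omega>"
  shows "L2_norm \<omega> (kernel_op K f) \<le> r * L2_norm \<omega> f"
proof -
  define g where "g = kernel_op K f"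
  have g0: "g \<in> L2_0 \<omega>"
    unfolding g_def by (rule kernel_op_L2_0[OF f])
  have L: "f \<in> L2 \<omega>" "g \<in> L2 \<omega>"
    using f g0 L2_0_subset_L2 by auto
  have expand: "L2_inner \<omega> (\<lambda>x. 1 * f x + b * g x) (\<lambda>x. 1 * f x + b * g x)
      = L2_inner \<omega> f f + 2 * b * L2_inner \<omega> f g + b\<^sup>2 * L2_inner \<omega> g g" for b
    using L L2_lincomb[OF L, of 1 b] L2_inner_commute[of \<omega> g f]
    by (simp add: L2_inner_lincomb_left[where a = 1, simplified]
        L2_inner_lincomb_right[where a = 1, simplified] algebra_simps power2_eq_square)
  have expandK: "L2_inner \<omega> (\<lambda>x. 1 * f x + b * g x) (kernel_op K (\<lambda>x. 1 * f x + b * g x))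
      = L2_inner \<omega> f (kernel_op K f) + 2 * b * L2_inner \<omega> g g + b\<^sup>2 * L2_inner \<omega> g (kernel_op K g)" for b
  proof -
    have "L2_inner \<omega> (\<lambda>x. 1 * f x + b * g x) (kernel_op K (\<lambda>x. 1 * f x + b * g x))
        = 1 * L2_inner \<omega> f (kernel_op K (\<lambda>x. 1 * f x + b * g x))
          + b * L2_inner \<omega> g (kernel_op K (\<lambda>x. 1 * f x + b * g x))"
      by (rule L2_inner_lincomb_left[OF L kernel_op_L2(1)[OF L2_lincomb[OF L]]])
    also have "\<dots> = 1 * (1 * L2_inner \<omega> f (kernel_op K f) + b * L2_inner \<omega> f (kernel_op K g))
          + b * (1 * L2_inner \<omega> g (kernel_op K f) + b * L2_inner \<omega> g (kernel_op K g))"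
      unfolding inner_kernel_op_lincomb_right[OF L L(1)] inner_kernel_op_lincomb_right[OF L L(2)] ..
    also have "L2_inner \<omega> f (kernel_op K g) = L2_inner \<omega> g g"
      unfolding g_def by (rule kernel_op_self_adjoint[OF L[unfolded g_def]])
    also have "L2_inner \<omega> g (kernel_op K f) = L2_inner \<omega> g g"
      by (simp add: g_def)
    finally show ?thesis
      by (simp add: algebra_simps power2_eq_square)
  qed
  let ?F = "L2_inner \<omega> f f" and ?G = "L2_inner \<omega> g g" and ?X = "L2_inner \<omega> f g"
  have b: "\<bar>L2_inner \<omega> f (kernel_op K f) + 2 * b * ?G + b\<^sup>2 * L2_inner \<omega> g (kernel_op K g)\<bar>
      \<le> r * (?F + 2 * b * ?X + b\<^sup>2 * ?G)" for b
    using range[OF L2_0_lincomb[OF prob_space_axioms f g0, of 1 b]] unfolding expand expandK .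
  \<comment> \<open>Upper bound at \<open>b\<close> plus lower bound at \<open>- b\<close>: the pure
    terms of the form of \<open>K\<close> cancel, and so do the inner products \<open>?X\<close> on
    the right.\<close>
  have "4 * b * ?G \<le> 2 * r * (?F + b\<^sup>2 * ?G)" for b
  proof -
    have "4 * b * ?G \<le> r * (?F + 2 * b * ?X + b\<^sup>2 * ?G) + r * (?F + 2 * (- b) * ?X + (- b)\<^sup>2 * ?G)"
      using abs_le_D1[OF b[of b]] abs_le_D2[OF b[of "- b"]] by simp
    also have "\<dots> = 2 * r * (?F + b\<^sup>2 * ?G)"
      by (simp add: ring_distribs)
    finally show ?thesis .
  qed
  note * = this
  \<comment> \<open>The choice \<open>b = 1 / r\<close> turns the inequality into
    \<open>?G \<le> r\<^sup>2 * ?F\<close>.\<close>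
  define s where "s = inverse r"
  have s: "r * s = 1"
    using r by (simp add: s_def)
  have "4 * (r * s) * ?G = r * (4 * s * ?G)"
    by (simp add: mult_ac)
  also have "\<dots> \<le> r * (2 * r * (?F + s\<^sup>2 * ?G))"
    by (rule mult_left_mono[OF *]) (use r in simp)
  also have "\<dots> = 2 * (r\<^sup>2 * ?F) + 2 * (r * s)\<^sup>2 * ?G"
    by (simp add: algebra_simps power2_eq_square)
  finally have "?G \<le> r\<^sup>2 * ?F"
    unfolding s by simp
  then have "(L2_norm \<omega> g)\<^sup>2 \<le> (r * L2_norm \<omega> f)\<^sup>2"
    by (simp add: L2_norm_square power_mult_distrib)
  then show ?thesis
    unfolding g_def by (rule power2_le_imp_le) (use r in \<open>simp add: L2_norm_nonneg\<close>)
qed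

text \<open>Partial sums of the series for the resolvent applied to \<open>f\<close>. Working with
  finite sums, only limits of real numbers have to be taken. The factors 1 match the
  linear-combination lemmas.\<close>

primrec neumann_sum :: "('a \<Rightarrow> real) \<Rightarrow> nat \<Rightarrow> 'a \<Rightarrow> real" where
  "neumann_sum f 0 = (\<lambda>x. 0)"
| "neumann_sum f (Suc n) = (\<lambda>x. 1 * neumann_sum f n x + 1 * (kernel_op K ^^ n) f x)"

lemma neumann_sum_L2_0:
  assumes "f \<in> L2_0 \<omega>"
  shows "neumann_sum f n \<in> L2_0 \<omega>"
proof (induction n)
  case 0
  show ?case
    by (simp add: L2_0_def)
next
  case (Suc n)
  show ?case
    unfolding neumann_sum.simps
    by (rule L2_0_lincomb[OF prob_space_axioms Suc kernel_op_funpow_L2_0[OF assms]])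
qed

lemma neumann_sum_L2: "f \<in> L2_0 \<omega> \<Longrightarrow> neumann_sum f n \<in> L2 \<omega>"
  using neumann_sum_L2_0 L2_0_subset_L2 by blast

lemma inner_neumann_sum:
  assumes f: "f \<in> L2_0 \<omega>" and h: "h \<in> L2 \<omega>"
  shows "L2_inner \<omega> h (neumann_sum f n) = (\<Sum>k<n. L2_inner \<omega> h ((kernel_op K ^^ k) f))"
proof (induction n)
  case 0
  show ?case
    by (simp add: L2_inner_def)
next
  case (Suc n)
  have "(kernel_op K ^^ n) f \<in> L2 \<omega>"
    using kernel_op_funpow_L2_0[OF f] L2_0_subset_L2 by blast
  then show ?case
    unfolding neumann_sum.simps
    by (subst L2_inner_lincomb_right[OF neumann_sum_L2[OF f] _ h]) (auto simp: Suc)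
qed

text \<open>Telescoping of \<open>(I - K)\<close> applied to the partial sum, tested against
  \<open>h\<close>. Self-adjointness moves \<open>K\<close> onto \<open>h\<close>, so linearity is
  needed only in the inner product.\<close>

lemma inner_kernel_neumann_sum:
  assumes f: "f \<in> L2_0 \<omega>" and h: "h \<in> L2 \<omega>"
  shows "L2_inner \<omega> h (neumann_sum f n) - L2_inner \<omega> h (kernel_op K (neumann_sum f n))
    = L2_inner \<omega> h f - L2_inner \<omega> h ((kernel_op K ^^ n) f)"
proof -
  have "L2_inner \<omega> h (kernel_op K (neumann_sum f n)) = L2_inner \<omega> (kernel_op K h) (neumann_sum f n)"
    by (subst kernel_op_self_adjoint[OF h neumann_sum_L2[OF f]]) (rule L2_inner_commute)
  also have "\<dots> = (\<Sum>k<n. L2_inner \<omega> h ((kernel_op K ^^ Suc k) f))"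
    unfolding inner_neumann_sum[OF f kernel_op_L2(1)[OF h]]
  proof (rule sum.cong)
    fix k
    have "(kernel_op K ^^ k) f \<in> L2 \<omega>"
      using kernel_op_funpow_L2_0[OF f] L2_0_subset_L2 by blast
    from kernel_op_self_adjoint[OF h this]
    show "L2_inner \<omega> (kernel_op K h) ((kernel_op K ^^ k) f) = L2_inner \<omega> h ((kernel_op K ^^ Suc k) f)"
      by (simp add: L2_inner_commute[of \<omega> "kernel_op K h"])
  qed simp
  finally have E: "L2_inner \<omega> h (kernel_op K (neumann_sum f n))
      = (\<Sum>k<n. L2_inner \<omega> h ((kernel_op K ^^ Suc k) f))" .
  have "(\<Sum>k<n. L2_inner \<omega> h ((kernel_op K ^^ k) f)) - (\<Sum>k<n. L2_inner \<omega> h ((kernel_op K ^^ Suc k) f))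
      = L2_inner \<omega> h ((kernel_op K ^^ 0) f) - L2_inner \<omega> h ((kernel_op K ^^ n) f)"
    by (rule trans[OF sum_subtractf[symmetric] sum_lessThan_telescope'])
  then show ?thesis
    unfolding inner_neumann_sum[OF f h] E funpow_0 .
qed

text \<open>A geometric series bounds the partial sums uniformly in \<open>n\<close>; tested against
  the \<open>n\<close>-th power of a contraction they therefore vanish in the limit.\<close>

lemma inner_neumann_sum_le:
  assumes contr: "\<And>g. g \<in> L2_0 \<omega> \<Longrightarrow> L2_norm \<omega> (kernel_op K g) \<le> r * L2_norm \<omega> g" and r: "0 \<le> r" "r < 1"
    and f: "f \<in> L2_0 \<omega>" and h: "h \<in> L2 \<omega>"
  shows "\<bar>L2_inner \<omega> (neumann_sum f n) h\<bar> \<le> L2_norm \<omega> f / (1 - r) * L2_norm \<omega> h"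
proof -
  have "\<bar>L2_inner \<omega> (neumann_sum f n) h\<bar> \<le> (\<Sum>k<n. \<bar>L2_inner \<omega> h ((kernel_op K ^^ k) f)\<bar>)"
    unfolding L2_inner_commute[of \<omega> "neumann_sum f n"] inner_neumann_sum[OF f h] by (rule sum_abs)
  also have "\<dots> \<le> (\<Sum>k<n. L2_norm \<omega> h * L2_norm \<omega> f * r ^ k)"
    by (intro sum_mono inner_funpow_le[OF contr r(1) f h])
  also have "\<dots> = L2_norm \<omega> h * L2_norm \<omega> f * (\<Sum>k<n. r ^ k)"
    by (simp add: sum_distrib_left)
  also have "\<dots> \<le> L2_norm \<omega> h * L2_norm \<omega> f * (1 / (1 - r))"
  proof (rule mult_left_mono)
    have "(\<Sum>k<n. r ^ k) = (1 - r ^ n) / (1 - r)"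
      using r by (simp add: sum_gp_strict)
    also have "\<dots> \<le> 1 / (1 - r)"
      using r by (intro divide_right_mono) auto
    finally show "(\<Sum>k<n. r ^ k) \<le> 1 / (1 - r)" .
  qed (simp add: L2_norm_nonneg)
  finally show ?thesis
    by (simp add: mult_ac)
qed

end

text \<open>The quadratic form of \<open>I - K\<close> is nonnegative at \<open>c u - v\<close>, where \<open>u\<close> and \<open>v\<close> are
  partial Neumann sums approximating \<open>(I - K)\<^sup>-\<^sup>1 f\<close> and \<open>(I - H)\<^sup>-\<^sup>1 f\<close>.
  Expanding it and letting the number of terms tend to infinity gives the claim.\<close>

lemma resolvent_comparison:
  fixes \<omega> :: "'a::topological_space measure"
  assumes K: "reversible_kernel \<omega> K" and H: "reversible_kernel \<omega> H"
    and contrK: "\<And>g. g \<in> L2_0 \<omega> \<Longrightarrow> L2_norm \<omega> (kernel_op K g) \<le> \<rho> * L2_norm \<omega> g"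
    and \<rho>: "0 \<le> \<rho>" "\<rho> < 1"
    and contrH: "\<And>g. g \<in> L2_0 \<omega> \<Longrightarrow> L2_norm \<omega> (kernel_op H g) \<le> r * L2_norm \<omega> g"
    and r: "0 \<le> r" "r < 1"
    and psd: "\<And>g. g \<in> L2_0 \<omega> \<Longrightarrow> L2_inner \<omega> g (kernel_op K g) \<le> L2_inner \<omega> g g"
    and dir: "\<And>g. g \<in> L2_0 \<omega> \<Longrightarrow> L2_inner \<omega> g g - L2_inner \<omega> g (kernel_op K g)
      \<le> c * (L2_inner \<omega> g g - L2_inner \<omega> g (kernel_op H g))"
    and c: "c > 0" and f: "f \<in> L2_0 \<omega>"
  shows "(\<Sum>k. L2_inner \<omega> f ((kernel_op H ^^ k) f)) \<le> c * (\<Sum>k. L2_inner \<omega> f ((kernel_op K ^^ k) f))"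
proof -
  interpret K: reversible_kernel \<omega> K
    by (rule K)
  interpret H: reversible_kernel \<omega> H
    by (rule H)
  have fL: "f \<in> L2 \<omega>"
    using f L2_0_subset_L2 by auto
  define u v where "u = K.neumann_sum f" and "v = H.neumann_sum f"
  define a b where "a n = (\<Sum>k<n. L2_inner \<omega> f ((kernel_op K ^^ k) f))"
    and "b n = (\<Sum>k<n. L2_inner \<omega> f ((kernel_op H ^^ k) f))" for n
  \<comment> \<open>The telescoping remainders: for \<open>u\<close> and \<open>v\<close> tested
    with the \<open>K\<close>-power of \<open>f\<close>, and for \<open>v\<close> with the
    \<open>H\<close>-power.\<close>
  define e1 e2 e3 where "e1 n = L2_inner \<omega> (u n) ((kernel_op K ^^ n) f)"
    and "e2 n = L2_inner \<omega> (v n) ((kernel_op K ^^ n) f)"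
    and "e3 n = L2_inner \<omega> (v n) ((kernel_op H ^^ n) f)" for n
  have u0: "u n \<in> L2_0 \<omega>" and v0: "v n \<in> L2_0 \<omega>" for n
    unfolding u_def v_def by (rule K.neumann_sum_L2_0[OF f] H.neumann_sum_L2_0[OF f])+
  then have uL: "u n \<in> L2 \<omega>" and vL: "v n \<in> L2 \<omega>" for n
    using L2_0_subset_L2 by blast+
  have ua: "L2_inner \<omega> (u n) f = a n" and vb: "L2_inner \<omega> (v n) f = b n" for n
    using K.inner_neumann_sum[OF f fL] H.inner_neumann_sum[OF f fL]
    by (simp_all add: L2_inner_commute[of \<omega> _ f] a_def b_def u_def v_def)
  \<comment> \<open>This is the expanded form at \<open>c u - v\<close>, divided by
    \<open>c\<close>. Hypothesis \<open>dir\<close> replaces the \<open>K\<close>-form at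
    \<open>v\<close> by \<open>c\<close> times its \<open>H\<close>-form, the one that telescopes
    for \<open>v\<close>.\<close>
  have key: "0 \<le> c * a n - b n - c * e1 n + 2 * e2 n - e3 n" for n
  proof -
    define \<beta> where "\<beta> x y = L2_inner \<omega> x y - L2_inner \<omega> x (kernel_op K y)" for x y
    let ?w = "\<lambda>x. c * u n x + (- 1) * v n x"
    have w0: "?w \<in> L2_0 \<omega>"
      by (rule L2_0_lincomb[OF K.prob_space_axioms u0 v0])
    have wL: "?w \<in> L2 \<omega>"
      by (rule L2_lincomb[OF uL vL])
    have right: "\<beta> h ?w = c * \<beta> h (u n) + (- 1) * \<beta> h (v n)" if "h \<in> L2 \<omega>" for h
      unfolding \<beta>_def L2_inner_lincomb_right[OF uL vL that] K.inner_kernel_op_lincomb_right[OF uL vL that]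
      by (simp add: algebra_simps)
    have left: "\<beta> ?w h = c * \<beta> (u n) h + (- 1) * \<beta> (v n) h" if "h \<in> L2 \<omega>" for h
      unfolding \<beta>_def L2_inner_lincomb_left[OF uL vL that] L2_inner_lincomb_left[OF uL vL K.kernel_op_L2(1)[OF that]]
      by (simp add: algebra_simps)
    have sym: "\<beta> (u n) (v n) = \<beta> (v n) (u n)"
      unfolding \<beta>_def by (simp add: L2_inner_commute[of \<omega> "u n" "v n"] K.kernel_op_self_adjoint[OF uL vL])
    have uu: "\<beta> (u n) (u n) = a n - e1 n"
      using K.inner_kernel_neumann_sum[OF f uL] by (simp add: \<beta>_def u_def[symmetric] ua e1_def)
    \<comment> \<open>The \<open>K\<close>-sum \<open>u n\<close> stands on the right, so the mixed
      term telescopes although \<open>v n\<close> belongs to \<open>H\<close>.\<close>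
    have vu: "\<beta> (v n) (u n) = b n - e2 n"
      using K.inner_kernel_neumann_sum[OF f vL] by (simp add: \<beta>_def u_def[symmetric] vb e2_def)
    have vv: "\<beta> (v n) (v n) \<le> c * (b n - e3 n)"
      using dir[OF v0] H.inner_kernel_neumann_sum[OF f vL] by (simp add: \<beta>_def v_def[symmetric] vb e3_def)
    have "0 \<le> \<beta> ?w ?w"
      using psd[OF w0] by (simp add: \<beta>_def)
    also have "\<dots> = c * (c * (a n - e1 n) - (b n - e2 n)) - (c * (b n - e2 n) - \<beta> (v n) (v n))"
      unfolding right[OF wL] left[OF uL] left[OF vL] sym uu vu by (simp add: algebra_simps)
    also have "\<dots> \<le> c * (c * a n - b n - c * e1 n + 2 * e2 n - e3 n)"
      using vv by (simp add: algebra_simps)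
    finally show ?thesis
      using c by (simp add: zero_le_mult_iff)
  qed
  \<comment> \<open>Each remainder is at most a constant times a power of \<rho> or of
    \<open>r\<close>.\<close>
  have e0: "e \<longlonglongrightarrow> 0" if "0 \<le> q" "q < 1" "\<And>n. \<bar>e n\<bar> \<le> C * (q ^ n * D)" for e :: "nat \<Rightarrow> real" and C D q
  proof (rule Lim_null_comparison)
    have "(\<lambda>n. C * (q ^ n * D)) \<longlonglongrightarrow> C * (0 * D)"
      by (intro tendsto_intros LIMSEQ_power_zero) (use that in auto)
    then show "(\<lambda>n. C * (q ^ n * D)) \<longlonglongrightarrow> 0"
      by simp
  qed (use that in auto)
  have KL: "(kernel_op K ^^ n) f \<in> L2 \<omega>" and HL: "(kernel_op H ^^ n) f \<in> L2 \<omega>" for n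
    using K.kernel_op_funpow_L2[OF fL] H.kernel_op_funpow_L2[OF fL] by auto
  have e1: "e1 \<longlonglongrightarrow> 0"
  proof (rule e0[OF \<rho>])
    fix n
    have "\<bar>e1 n\<bar> \<le> L2_norm \<omega> f / (1 - \<rho>) * L2_norm \<omega> ((kernel_op K ^^ n) f)"
      unfolding e1_def u_def by (rule K.inner_neumann_sum_le[OF contrK \<rho> f KL])
    also have "\<dots> \<le> L2_norm \<omega> f / (1 - \<rho>) * (\<rho> ^ n * L2_norm \<omega> f)"
      using \<rho> by (intro mult_left_mono K.funpow_norm_le[OF contrK \<rho>(1) f]) (auto simp: L2_norm_nonneg)
    finally show "\<bar>e1 n\<bar> \<le> L2_norm \<omega> f / (1 - \<rho>) * (\<rho> ^ n * L2_norm \<omega> f)" .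
  qed
  have e2: "e2 \<longlonglongrightarrow> 0"
  proof (rule e0[OF \<rho>])
    fix n
    have "\<bar>e2 n\<bar> \<le> L2_norm \<omega> f / (1 - r) * L2_norm \<omega> ((kernel_op K ^^ n) f)"
      unfolding e2_def v_def by (rule H.inner_neumann_sum_le[OF contrH r f KL])
    also have "\<dots> \<le> L2_norm \<omega> f / (1 - r) * (\<rho> ^ n * L2_norm \<omega> f)"
      using r by (intro mult_left_mono K.funpow_norm_le[OF contrK \<rho>(1) f]) (auto simp: L2_norm_nonneg)
    finally show "\<bar>e2 n\<bar> \<le> L2_norm \<omega> f / (1 - r) * (\<rho> ^ n * L2_norm \<omega> f)" .
  qed
  have e3: "e3 \<longlonglongrightarrow> 0"
  proof (rule e0[OF r])
    fix n
    have "\<bar>e3 n\<bar> \<le> L2_norm \<omega> f / (1 - r) * L2_norm \<omega> ((kernel_op H ^^ n) f)"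
      unfolding e3_def v_def by (rule H.inner_neumann_sum_le[OF contrH r f HL])
    also have "\<dots> \<le> L2_norm \<omega> f / (1 - r) * (r ^ n * L2_norm \<omega> f)"
      using r by (intro mult_left_mono H.funpow_norm_le[OF contrH r(1) f]) (auto simp: L2_norm_nonneg)
    finally show "\<bar>e3 n\<bar> \<le> L2_norm \<omega> f / (1 - r) * (r ^ n * L2_norm \<omega> f)" .
  qed
  have sK: "summable (\<lambda>k. L2_inner \<omega> f ((kernel_op K ^^ k) f))"
    using K.inner_funpow_le[OF contrK \<rho>(1) f fL] \<rho>
    by (intro summable_comparison_test'[OF summable_mult[OF summable_geometric[of \<rho>]], of 0]) auto
  have sH: "summable (\<lambda>k. L2_inner \<omega> f ((kernel_op H ^^ k) f))"
    using H.inner_funpow_le[OF contrH r(1) f fL] r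
    by (intro summable_comparison_test'[OF summable_mult[OF summable_geometric[of r]], of 0]) auto
  have "(\<lambda>n. c * a n - b n - c * e1 n + 2 * e2 n - e3 n) \<longlonglongrightarrow>
      c * (\<Sum>k. L2_inner \<omega> f ((kernel_op K ^^ k) f)) - (\<Sum>k. L2_inner \<omega> f ((kernel_op H ^^ k) f))
        - c * 0 + 2 * 0 - 0"
    unfolding a_def b_def by (intro tendsto_intros e1 e2 e3 summable_LIMSEQ sK sH)
  then have "0 \<le> c * (\<Sum>k. L2_inner \<omega> f ((kernel_op K ^^ k) f)) - (\<Sum>k. L2_inner \<omega> f ((kernel_op H ^^ k) f))
        - c * 0 + 2 * 0 - 0"
    by (rule LIMSEQ_le_const) (use key in blast)
  then show ?thesis
    by simp
qed


section \<open>Disintegration of hybrid data augmentation\<close>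

text \<open>The inner kernel \<open>Q\<close> is a parameter, so that exact sampling can later be
  treated as an instance.\<close>

locale hybrid_augmentation =
  fixes P :: "('a::polish_space \<times> 'b::polish_space) measure"
    and P1 :: "'b \<Rightarrow> 'a measure" and P2 :: "'a \<Rightarrow> 'b measure"
    and M1 :: "'a measure" and M2 :: "'b measure"
    and Q :: "'b \<Rightarrow> 'a \<Rightarrow> 'a measure"
  assumes prob_P: "prob_space P" and sets_P: "sets P = sets borel"
    and M1_def: "M1 = distr P borel fst" and M2_def: "M2 = distr P borel snd"
    and cond2: "cond_distribution P snd fst P2"
    and cond1: "cond_distribution P fst snd P1"
    and markov_Q: "\<And>z. markov_kernel (Q z)"
    and reversible_Q: "\<And>z. reversible (P1 z) (Q z)"
    and measurable_emeasure_Q: "\<And>A. A \<in> sets borel \<Longrightarrow>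
      (\<lambda>(y, z). emeasure (Q z y) A) \<in> borel_measurable (borel \<Otimes>\<^sub>M borel)"
begin

section \<open>The two disintegrations of the joint distribution\<close>

lemma sets_P_pair [measurable_cong, simp]: "sets P = sets (borel \<Otimes>\<^sub>M borel)"
  unfolding borel_prod by (rule sets_P)

lemma space_P [simp]: "space P = UNIV"
  using sets_eq_imp_space_eq[OF sets_P] by simp

lemma measurable_P_fst [measurable]: "fst \<in> P \<rightarrow>\<^sub>M borel"
  and measurable_P_snd [measurable]: "snd \<in> P \<rightarrow>\<^sub>M borel"
  by measurable

sublocale P: prob_space P
  by (rule prob_P)

sublocale A: markov_pair M1 P2
proof (intro markov_pair.intro markov_pair_axioms.intro)
  show "prob_space M1"
    unfolding M1_def by (rule P.prob_space_distr[OF measurable_P_fst])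
qed (use cond2 in \<open>auto simp: M1_def cond_distribution_def\<close>)

sublocale B: markov_pair M2 P1
proof (intro markov_pair.intro markov_pair_axioms.intro)
  show "prob_space M2"
    unfolding M2_def by (rule P.prob_space_distr[OF measurable_P_snd])
qed (use cond1 in \<open>auto simp: M2_def cond_distribution_def\<close>)

lemma fibre_reversible_kernel: "reversible_kernel (P1 z) (Q z)"
  by (intro reversible_kernel.intro markov_pair.intro markov_pair_axioms.intro
      reversible_kernel_axioms.intro B.prob_space_kernel B.sets_kernel_borel markov_Q reversible_Q)

lemma joint_law_1: "joint_law M1 P2 = P"
proof (rule measure_eqI_Times)
  show "finite_measure (joint_law M1 P2)"
    using A.prob_space_joint by (simp add: prob_space_def)
  fix X :: "'a set" and Y :: "'b set"
  assume [measurable]: "X \<in> sets borel" "Y \<in> sets borel"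
  have "emeasure P {w \<in> space P. snd w \<in> Y \<and> fst w \<in> X} = (\<integral>\<^sup>+ y \<in> X. emeasure (P2 y) Y \<partial>M1)"
    using cond2 by (simp add: cond_distribution_def M1_def)
  also have "{w \<in> space P. snd w \<in> Y \<and> fst w \<in> X} = X \<times> Y"
    by auto
  finally show "emeasure (joint_law M1 P2) (X \<times> Y) = emeasure P (X \<times> Y)"
    by (simp add: A.emeasure_joint_Times)
qed auto

lemma joint_law_2: "joint_law M2 P1 = distr P (borel \<Otimes>\<^sub>M borel) (\<lambda>w. (snd w, fst w))"
proof (rule measure_eqI_Times)
  show "finite_measure (joint_law M2 P1)"
    using B.prob_space_joint by (simp add: prob_space_def)
  fix X :: "'b set" and Y :: "'a set"
  assume [measurable]: "X \<in> sets borel" "Y \<in> sets borel"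
  have "emeasure P {w \<in> space P. fst w \<in> Y \<and> snd w \<in> X} = (\<integral>\<^sup>+ z \<in> X. emeasure (P1 z) Y \<partial>M2)"
    using cond1 by (simp add: cond_distribution_def M2_def)
  also have "{w \<in> space P. fst w \<in> Y \<and> snd w \<in> X} = (\<lambda>w. (snd w, fst w)) -` (X \<times> Y) \<inter> space P"
    by auto
  finally show "emeasure (joint_law M2 P1) (X \<times> Y)
      = emeasure (distr P (borel \<Otimes>\<^sub>M borel) (\<lambda>w. (snd w, fst w))) (X \<times> Y)"
    by (subst emeasure_distr) (auto simp: B.emeasure_joint_Times)
qed auto

text \<open>Both iterated integrals equal the integral against \<open>P\<close>. This is the passage
  between integration along \<open>M1\<close> and integration over the fibres above
  \<open>M2\<close>.\<close>

lemma nn_integral_disintegrate: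
  assumes [measurable]: "h \<in> borel_measurable (borel \<Otimes>\<^sub>M borel)"
  shows "(\<integral>\<^sup>+y. (\<integral>\<^sup>+z. h (y, z) \<partial>P2 y) \<partial>M1) = (\<integral>\<^sup>+z. (\<integral>\<^sup>+y. h (y, z) \<partial>P1 z) \<partial>M2)"
proof -
  have "(\<integral>\<^sup>+y. (\<integral>\<^sup>+z. h (y, z) \<partial>P2 y) \<partial>M1) = (\<integral>\<^sup>+w. h w \<partial>P)"
    using A.nn_integral_joint[OF assms] by (simp add: joint_law_1)
  also have "\<dots> = (\<integral>\<^sup>+w. h (snd w, fst w) \<partial>joint_law M2 P1)"
    unfolding joint_law_2 by (subst nn_integral_distr) auto
  also have "\<dots> = (\<integral>\<^sup>+z. (\<integral>\<^sup>+y. h (y, z) \<partial>P1 z) \<partial>M2)"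
    by (subst B.nn_integral_joint) auto
  finally show ?thesis .
qed

text \<open>Joint measurability of the values on sets lifts to a map into the space of measures, as
  binding over \<open>z\<close> requires.\<close>

lemma measurable_Q_pair: "(\<lambda>(y, z). Q z y) \<in> borel \<Otimes>\<^sub>M borel \<rightarrow>\<^sub>M prob_algebra borel"
proof (rule measurable_prob_algebraI)
  show "(\<lambda>(y, z). Q z y) \<in> borel \<Otimes>\<^sub>M borel \<rightarrow>\<^sub>M subprob_algebra borel"
    by (rule measurable_subprob_algebra)
       (use measurable_emeasure_Q in \<open>auto simp: case_prod_beta sets_markov_kernel[OF markov_Q]
          intro!: prob_space_imp_subprob_space prob_space_markov_kernel[OF markov_Q]\<close>)
qed (auto intro: prob_space_markov_kernel[OF markov_Q])

lemma measurable_Q [measurable (raw)]: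
  assumes "g \<in> N \<rightarrow>\<^sub>M borel" "h \<in> N \<rightarrow>\<^sub>M borel"
  shows "(\<lambda>x. Q (g x) (h x)) \<in> N \<rightarrow>\<^sub>M prob_algebra borel"
  using measurable_compose[OF measurable_Pair[OF assms(2,1)] measurable_Q_pair] by simp

lemma markov_hybrid: "markov_kernel (DA_hybrid Q P2)"
  unfolding markov_kernel_def DA_hybrid_def[abs_def] by measurable

lemma Q_subprob: "(\<lambda>z. Q z y) \<in> P2 y \<rightarrow>\<^sub>M subprob_algebra borel"
  by (rule measurable_prob_algebraD) measurable

lemma nn_integral_hybrid:
  assumes "h \<in> borel_measurable borel"
  shows "(\<integral>\<^sup>+x. h x \<partial>DA_hybrid Q P2 y) = (\<integral>\<^sup>+z. (\<integral>\<^sup>+x. h x \<partial>Q z y) \<partial>P2 y)"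
  unfolding DA_hybrid_def by (rule nn_integral_bind[OF assms Q_subprob])

lemma nn_integral_hybrid_joint:
  assumes [measurable]: "h \<in> borel_measurable (borel \<Otimes>\<^sub>M borel)"
  shows "(\<integral>\<^sup>+y. (\<integral>\<^sup>+x. h (y, x) \<partial>DA_hybrid Q P2 y) \<partial>M1)
    = (\<integral>\<^sup>+z. (\<integral>\<^sup>+y. (\<integral>\<^sup>+x. h (y, x) \<partial>Q z y) \<partial>P1 z) \<partial>M2)"
proof -
  have "(\<lambda>w. Q (snd w) (fst w)) \<in> borel \<Otimes>\<^sub>M borel \<rightarrow>\<^sub>M subprob_algebra borel"
    by (rule measurable_prob_algebraD) measurable
  then have [measurable]: "(\<lambda>w. \<integral>\<^sup>+x. h (fst w, x) \<partial>Q (snd w) (fst w)) \<in> borel_measurable (borel \<Otimes>\<^sub>M borel)"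
    by (rule nn_integral_measurable_subprob_algebra2[rotated]) measurable
  have "(\<integral>\<^sup>+y. (\<integral>\<^sup>+x. h (y, x) \<partial>DA_hybrid Q P2 y) \<partial>M1)
      = (\<integral>\<^sup>+y. (\<integral>\<^sup>+z. (\<integral>\<^sup>+x. h (y, x) \<partial>Q z y) \<partial>P2 y) \<partial>M1)"
    by (intro nn_integral_cong nn_integral_hybrid) measurable
  also have "\<dots> = (\<integral>\<^sup>+z. (\<integral>\<^sup>+y. (\<integral>\<^sup>+x. h (y, x) \<partial>Q z y) \<partial>P1 z) \<partial>M2)"
    using nn_integral_disintegrate[of "\<lambda>w. \<integral>\<^sup>+x. h (fst w, x) \<partial>Q (snd w) (fst w)"] by simp
  finally show ?thesis .
qed

text \<open>Averaging over \<open>z\<close> the fibre measures, each symmetric because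
  \<open>Q z\<close> is reversible for \<open>P1 z\<close>, preserves symmetry.\<close>

sublocale H: reversible_kernel M1 "DA_hybrid Q P2"
proof -
  interpret H: markov_pair M1 "DA_hybrid Q P2"
    by (intro markov_pair.intro markov_pair_axioms.intro A.prob_space_axioms A.sets_base markov_hybrid)
  have "reversible M1 (DA_hybrid Q P2)"
    unfolding reversible_def
  proof (intro ballI)
    fix X Y :: "'a set" assume XY [measurable]: "X \<in> sets borel" "Y \<in> sets borel"
    \<comment> \<open>Stated for arbitrary sets so that it also applies with the two sets
      exchanged.\<close>
    have *: "(\<integral>\<^sup>+ y \<in> X. emeasure (DA_hybrid Q P2 y) Y \<partial>M1)
        = (\<integral>\<^sup>+z. (\<integral>\<^sup>+ y \<in> X. emeasure (Q z y) Y \<partial>P1 z) \<partial>M2)"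
      if [measurable]: "X \<in> sets borel" "Y \<in> sets borel" for X Y :: "'a set"
    proof -
      have "(\<integral>\<^sup>+ y \<in> X. emeasure (DA_hybrid Q P2 y) Y \<partial>M1)
          = (\<integral>\<^sup>+y. (\<integral>\<^sup>+x. indicator (X \<times> Y) (y, x) \<partial>DA_hybrid Q P2 y) \<partial>M1)"
        by (simp add: H.emeasure_joint_Times[symmetric] H.nn_integral_joint[symmetric])
      also have "\<dots> = (\<integral>\<^sup>+z. (\<integral>\<^sup>+y. (\<integral>\<^sup>+x. indicator (X \<times> Y) (y, x) \<partial>Q z y) \<partial>P1 z) \<partial>M2)"
        by (rule nn_integral_hybrid_joint) measurable
      also have "\<dots> = (\<integral>\<^sup>+z. (\<integral>\<^sup>+ y \<in> X. emeasure (Q z y) Y \<partial>P1 z) \<partial>M2)"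
      proof (rule nn_integral_cong)
        fix z
        interpret Qz: reversible_kernel "P1 z" "Q z"
          by (rule fibre_reversible_kernel)
        show "(\<integral>\<^sup>+y. (\<integral>\<^sup>+x. indicator (X \<times> Y) (y, x) \<partial>Q z y) \<partial>P1 z) = (\<integral>\<^sup>+ y \<in> X. emeasure (Q z y) Y \<partial>P1 z)"
          by (simp add: Qz.emeasure_joint_Times[symmetric] Qz.nn_integral_joint[symmetric])
      qed
      finally show ?thesis .
    qed
    have "(\<integral>\<^sup>+ y \<in> X. emeasure (Q z y) Y \<partial>P1 z) = (\<integral>\<^sup>+ y \<in> Y. emeasure (Q z y) X \<partial>P1 z)" for z
      using reversible_Q[of z] XY by (simp add: reversible_def)
    then show "(\<integral>\<^sup>+ y \<in> X. emeasure (DA_hybrid Q P2 y) Y \<partial>M1) = (\<integral>\<^sup>+ y \<in> Y. emeasure (DA_hybrid Q P2 y) X \<partial>M1)"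
      by (simp add: *)
  qed
  then show "reversible_kernel M1 (DA_hybrid Q P2)"
    by unfold_locales
qed

section \<open>The hybrid kernel as a mixture over fibres\<close>

lemma fibre_joint_measurable:
  "(\<lambda>z. joint_law (P1 z) (Q z)) \<in> borel \<rightarrow>\<^sub>M prob_algebra (borel \<Otimes>\<^sub>M borel)"
  unfolding joint_law_def by measurable

text \<open>As an identity of measures this makes the quadratic form of the hybrid kernel an average
  of fibre forms, also for integrands of varying sign.\<close>

lemma hybrid_joint_mixture:
  "joint_law M1 (DA_hybrid Q P2) = M2 \<bind> (\<lambda>z. joint_law (P1 z) (Q z))"
proof (rule measure_eqI)
  have k: "(\<lambda>z. joint_law (P1 z) (Q z)) \<in> M2 \<rightarrow>\<^sub>M subprob_algebra (borel \<Otimes>\<^sub>M borel)"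
    using measurable_prob_algebraD[OF fibre_joint_measurable] by simp
  show "sets (joint_law M1 (DA_hybrid Q P2)) = sets (M2 \<bind> (\<lambda>z. joint_law (P1 z) (Q z)))"
    by (subst sets_bind[OF sets_kernel[OF k]]) auto
  fix X assume "X \<in> sets (joint_law M1 (DA_hybrid Q P2))"
  then have [measurable]: "X \<in> sets (borel \<Otimes>\<^sub>M borel)"
    by simp
  have "emeasure (joint_law M1 (DA_hybrid Q P2)) X = (\<integral>\<^sup>+w. indicator X w \<partial>joint_law M1 (DA_hybrid Q P2))"
    by simp
  also have "\<dots> = (\<integral>\<^sup>+y. (\<integral>\<^sup>+x. indicator X (y, x) \<partial>DA_hybrid Q P2 y) \<partial>M1)"
    by (rule H.nn_integral_joint) measurable
  also have "\<dots> = (\<integral>\<^sup>+z. (\<integral>\<^sup>+y. (\<integral>\<^sup>+x. indicator X (y, x) \<partial>Q z y) \<partial>P1 z) \<partial>M2)"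
    by (rule nn_integral_hybrid_joint) measurable
  also have "\<dots> = (\<integral>\<^sup>+z. emeasure (joint_law (P1 z) (Q z)) X \<partial>M2)"
  proof (rule nn_integral_cong)
    fix z
    interpret Qz: reversible_kernel "P1 z" "Q z"
      by (rule fibre_reversible_kernel)
    show "(\<integral>\<^sup>+y. (\<integral>\<^sup>+x. indicator X (y, x) \<partial>Q z y) \<partial>P1 z) = emeasure (joint_law (P1 z) (Q z)) X"
      by (simp add: Qz.nn_integral_joint[symmetric])
  qed
  also have "\<dots> = emeasure (M2 \<bind> (\<lambda>z. joint_law (P1 z) (Q z))) X"
    by (rule emeasure_bind[symmetric, OF _ k]) auto
  finally show "emeasure (joint_law M1 (DA_hybrid Q P2)) X = emeasure (M2 \<bind> (\<lambda>z. joint_law (P1 z) (Q z))) X" .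
qed

lemma base_mixture: "M2 \<bind> P1 = M1"
proof (rule measure_eqI)
  have k: "P1 \<in> M2 \<rightarrow>\<^sub>M subprob_algebra borel"
    by measurable
  show s: "sets (M2 \<bind> P1) = sets M1"
    by (subst sets_bind[OF sets_kernel[OF k]]) auto
  fix X assume "X \<in> sets (M2 \<bind> P1)"
  then have [measurable]: "X \<in> sets borel"
    using s by simp
  have "emeasure (M2 \<bind> P1) X = (\<integral>\<^sup>+z. (\<integral>\<^sup>+y. indicator X y \<partial>P1 z) \<partial>M2)"
    by (subst emeasure_bind[OF _ k]) auto
  also have "\<dots> = (\<integral>\<^sup>+y. (\<integral>\<^sup>+z. indicator X y \<partial>P2 y) \<partial>M1)"
    using nn_integral_disintegrate[of "\<lambda>w. indicator X (fst w)"] by simp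
  also have "\<dots> = emeasure M1 X"
    using prob_space.emeasure_space_1[OF A.prob_space_kernel] by simp
  finally show "emeasure (M2 \<bind> P1) X = emeasure M1 X" .
qed

lemma
  assumes f: "f \<in> L2 M1"
  shows AE_fibre_L2: "AE z in M2. f \<in> L2 (P1 z)"
    and integrable_fibre_square: "integrable M2 (\<lambda>z. L2_inner (P1 z) f f)"
    and integral_fibre_square: "L2_inner M1 f f = (\<integral>z. L2_inner (P1 z) f f \<partial>M2)"
proof -
  note [measurable] = H.L2_borel_measurable[OF f]
  have k: "P1 \<in> M2 \<rightarrow>\<^sub>M subprob_algebra borel" and m: "(\<lambda>x. (f x)\<^sup>2) \<in> borel_measurable borel"
    by measurable
  have int: "integrable (M2 \<bind> P1) (\<lambda>x. (f x)\<^sup>2)"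
    unfolding base_mixture by (rule L2_square_integrable[OF f])
  have "f \<in> borel_measurable (P1 z)" for z
    by (subst measurable_cong_sets[OF B.sets_kernel_borel refl]) (rule H.L2_borel_measurable[OF f])
  then show "AE z in M2. f \<in> L2 (P1 z)"
    using AE_integrable_bind[OF k m int] by (simp add: L2_def)
  show "integrable M2 (\<lambda>z. L2_inner (P1 z) f f)"
    using integrable_integral_bind[OF k m int] by (simp add: L2_inner_def power2_eq_square)
  show "L2_inner M1 f f = (\<integral>z. L2_inner (P1 z) f f \<partial>M2)"
    using integral_bind_eq[OF k m int] by (simp add: L2_inner_def power2_eq_square base_mixture)
qed

text \<open>The mixture formula is applied to \<open>f(y) f(x)\<close>. On almost every fibre
  \<open>f\<close> is square-integrable, and there the inner integral is the form of
  \<open>Q z\<close>.\<close>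

lemma
  assumes f: "f \<in> L2 M1"
  shows integrable_fibre_inner: "integrable M2 (\<lambda>z. L2_inner (P1 z) f (kernel_op (Q z) f))"
    and integral_fibre_inner:
      "L2_inner M1 f (kernel_op (DA_hybrid Q P2) f) = (\<integral>z. L2_inner (P1 z) f (kernel_op (Q z) f) \<partial>M2)"
proof -
  note [measurable] = H.L2_borel_measurable[OF f]
  let ?F = "\<lambda>w. f (fst w) * f (snd w)"
  have k: "(\<lambda>z. joint_law (P1 z) (Q z)) \<in> M2 \<rightarrow>\<^sub>M subprob_algebra (borel \<Otimes>\<^sub>M borel)"
    using measurable_prob_algebraD[OF fibre_joint_measurable] by simp
  have m: "?F \<in> borel_measurable (borel \<Otimes>\<^sub>M borel)"
    by measurable
  have int: "integrable (M2 \<bind> (\<lambda>z. joint_law (P1 z) (Q z))) ?F"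
    unfolding hybrid_joint_mixture[symmetric] by (rule H.integrable_joint_mult[OF f f])
  have eq: "AE z in M2. (\<integral>w. ?F w \<partial>joint_law (P1 z) (Q z)) = L2_inner (P1 z) f (kernel_op (Q z) f)"
    using AE_fibre_L2[OF f]
  proof eventually_elim
    case (elim z)
    interpret Qz: reversible_kernel "P1 z" "Q z"
      by (rule fibre_reversible_kernel)
    show ?case
      by (rule Qz.inner_kernel_op_joint[OF elim elim, symmetric])
  qed
  \<comment> \<open>Measurability in \<open>z\<close> is shown directly, because the identity with
    the joint integral holds only almost everywhere.\<close>
  have meas: "(\<lambda>z. L2_inner (P1 z) f (kernel_op (Q z) f)) \<in> borel_measurable M2"
  proof -
    have q: "(\<lambda>w. Q (snd w) (fst w)) \<in> borel \<Otimes>\<^sub>M borel \<rightarrow>\<^sub>M subprob_algebra borel"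
      by (rule measurable_prob_algebraD) measurable
    have [measurable]: "(\<lambda>w. kernel_op (Q (snd w)) f (fst w)) \<in> borel_measurable (borel \<Otimes>\<^sub>M borel)"
      unfolding kernel_op_def
      by (rule measurable_compose[OF q integral_measurable_subprob_algebra]) measurable
    have G: "(\<lambda>w. f (fst w) * kernel_op (Q (snd w)) f (fst w)) \<in> borel_measurable (borel \<Otimes>\<^sub>M borel)"
      by measurable
    have Pz: "(\<lambda>y. (y, z)) \<in> P1 z \<rightarrow>\<^sub>M borel \<Otimes>\<^sub>M borel" for z
      by (subst measurable_cong_sets[OF B.sets_kernel_borel refl]) (rule measurable_Pair2', simp)
    \<comment> \<open>Carrying \<open>z\<close> along as a second coordinate makes the integrand
      fixed and leaves the dependence on \<open>z\<close> to the measure.\<close>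
    have P1z: "(\<lambda>z. distr (P1 z) (borel \<Otimes>\<^sub>M borel) (\<lambda>y. (y, z))) \<in> M2 \<rightarrow>\<^sub>M subprob_algebra (borel \<Otimes>\<^sub>M borel)"
      by (rule measurable_prob_algebraD) measurable
    have "(\<lambda>z. \<integral>w. f (fst w) * kernel_op (Q (snd w)) f (fst w) \<partial>distr (P1 z) (borel \<Otimes>\<^sub>M borel) (\<lambda>y. (y, z)))
        \<in> borel_measurable M2"
      by (rule measurable_compose[OF P1z integral_measurable_subprob_algebra[OF G]])
    also have "(\<lambda>z. \<integral>w. f (fst w) * kernel_op (Q (snd w)) f (fst w) \<partial>distr (P1 z) (borel \<Otimes>\<^sub>M borel) (\<lambda>y. (y, z)))
        = (\<lambda>z. L2_inner (P1 z) f (kernel_op (Q z) f))"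
      unfolding integral_distr[OF Pz G] by (simp add: L2_inner_def)
    finally show ?thesis .
  qed
  have i: "integrable M2 (\<lambda>z. \<integral>w. ?F w \<partial>joint_law (P1 z) (Q z))"
    by (rule integrable_integral_bind[OF k m int])
  show "integrable M2 (\<lambda>z. L2_inner (P1 z) f (kernel_op (Q z) f))"
    using i integrable_cong_AE[OF borel_measurable_integrable[OF i] meas eq] by simp
  have "L2_inner M1 f (kernel_op (DA_hybrid Q P2) f) = (\<integral>w. ?F w \<partial>joint_law M1 (DA_hybrid Q P2))"
    by (rule H.inner_kernel_op_joint[OF f f])
  also have "\<dots> = (\<integral>z. (\<integral>w. ?F w \<partial>joint_law (P1 z) (Q z)) \<partial>M2)"
    unfolding hybrid_joint_mixture by (rule integral_bind_eq[OF k m int])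
  also have "\<dots> = (\<integral>z. L2_inner (P1 z) f (kernel_op (Q z) f) \<partial>M2)"
    by (rule integral_cong_AE[OF borel_measurable_integrable[OF i] meas eq])
  finally show "L2_inner M1 f (kernel_op (DA_hybrid Q P2) f) = (\<integral>z. L2_inner (P1 z) f (kernel_op (Q z) f) \<partial>M2)" .
qed

end


section \<open>Energy comparison\<close>

context reversible_kernel
begin

text \<open>Split \<open>f\<close> into its mean and a centred part \<open>g\<close>. Constants are
  fixed by \<open>K\<close>, the cross terms vanish, and \<open>kernel_norm\<close> applies to
  \<open>g\<close>.\<close>

lemma
  assumes f: "f \<in> L2 \<omega>"
  shows square_expectation_le_inner: "(expectation f)\<^sup>2 \<le> L2_inner \<omega> f f"
    and inner_kernel_op_minus_mean: "\<bar>L2_inner \<omega> f (kernel_op K f) - (expectation f)\<^sup>2\<bar>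
      \<le> kernel_norm \<omega> K * (L2_inner \<omega> f f - (expectation f)\<^sup>2)"
proof -
  define m where "m = expectation f"
  define g where "g = (\<lambda>x. f x - m)"
  have g0: "g \<in> L2_0 \<omega>"
    unfolding g_def m_def by (rule L2_minus_mean[OF f])
  then have gL: "g \<in> L2 \<omega>" and gm: "expectation g = 0"
    using L2_0_subset_L2 by (auto simp: L2_0_def)
  have one: "(\<lambda>_. 1) \<in> L2 \<omega>"
    by (rule L2_const)
  have f_eq: "f = (\<lambda>x. 1 * g x + m * 1)"
    by (simp add: g_def)
  have K1: "kernel_op K (\<lambda>_. 1) = (\<lambda>_. 1)"
    using prob_space.prob_space[OF prob_space_kernel] by (simp add: kernel_op_def fun_eq_iff)
  have g1: "L2_inner \<omega> g (\<lambda>_. 1) = 0" "L2_inner \<omega> (\<lambda>_. 1) g = 0"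
    using gm by (simp_all add: L2_inner_def)
  have oo: "L2_inner \<omega> (\<lambda>_. 1) (\<lambda>_. 1) = 1"
    using prob_space by (simp add: L2_inner_def)
  \<comment> \<open>Self-adjointness moves \<open>K\<close> onto the constant 1, which it
    fixes.\<close>
  have gK: "L2_inner \<omega> (\<lambda>_. 1) (kernel_op K g) = 0"
    using kernel_op_self_adjoint[OF one gL] by (simp add: K1 g1)
  have "L2_inner \<omega> f h = L2_inner \<omega> g h + m * L2_inner \<omega> (\<lambda>_. 1) h" if "h \<in> L2 \<omega>" for h
    using L2_inner_lincomb_left[OF gL one that, of 1 m] unfolding f_eq[symmetric] by simp
  note left = this
  have "L2_inner \<omega> h f = L2_inner \<omega> h g + m * L2_inner \<omega> h (\<lambda>_. 1)" if "h \<in> L2 \<omega>" for h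
    using L2_inner_lincomb_right[OF gL one that, of 1 m] unfolding f_eq[symmetric] by simp
  note right = this
  have "L2_inner \<omega> h (kernel_op K f) = L2_inner \<omega> h (kernel_op K g) + m * L2_inner \<omega> h (\<lambda>_. 1)"
    if "h \<in> L2 \<omega>" for h
    using inner_kernel_op_lincomb_right[OF gL one that, of 1 m] unfolding f_eq[symmetric] K1 by simp
  note rightK = this
  have ff: "L2_inner \<omega> f f = L2_inner \<omega> g g + m\<^sup>2"
    using left[OF f] right[OF gL] right[OF one] by (simp add: g1 oo power2_eq_square)
  have fK: "L2_inner \<omega> f (kernel_op K f) = L2_inner \<omega> g (kernel_op K g) + m\<^sup>2"
    using left[OF kernel_op_L2(1)[OF f]] rightK[OF gL] rightK[OF one] by (simp add: g1 oo gK power2_eq_square)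
  show "(expectation f)\<^sup>2 \<le> L2_inner \<omega> f f"
    unfolding m_def[symmetric] ff by (simp add: L2_inner_self_nonneg)
  show "\<bar>L2_inner \<omega> f (kernel_op K f) - (expectation f)\<^sup>2\<bar>
      \<le> kernel_norm \<omega> K * (L2_inner \<omega> f f - (expectation f)\<^sup>2)"
    unfolding m_def[symmetric] ff fK using inner_kernel_op_le[OF g0] by simp
qed

end

text \<open>On a fibre, \<open>F\<close> is the squared norm, \<open>m\<close> the squared mean,
  \<open>q\<close> the form of the kernel and \<open>g\<close> the norm bound. Then
  \<open>F - q\<close> is at least \<open>(1 - g) (F - m)\<close>, and \<open>F + q\<close> is at
  least that plus \<open>2 m\<close>; Bernoulli trades \<open>t (1 - g)\<close> for
  \<open>1 - g ^ t\<close>.\<close>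

lemma fibre_energy_bounds:
  fixes F m q g :: real
  assumes m: "0 \<le> m" "m \<le> F" and q: "\<bar>q - m\<bar> \<le> g * (F - m)" and g: "0 \<le> g" "g \<le> 1" and t: "t > 0"
  shows "F - m - g ^ t * F \<le> real t * (F - q)"
    and "F - g ^ t * F \<le> real t * (F + q)"
proof -
  have "1 + real t * (g - 1) \<le> (1 + (g - 1)) ^ t"
    by (rule Bernoulli_inequality) (use g in simp)
  then have "(1 - g ^ t) * (F - m) \<le> real t * (1 - g) * (F - m)"
    using m by (intro mult_right_mono) (auto simp: algebra_simps)
  then have *: "(1 - g ^ t) * (F - m) \<le> real t * ((1 - g) * (F - m))"
    by (simp only: mult.assoc)
  have gm: "0 \<le> g ^ t * m"
    using g m by simp
  have "real t * ((1 - g) * (F - m)) \<le> real t * (F - q)"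
    using q by (intro mult_left_mono) (auto simp: algebra_simps abs_le_iff)
  with * gm show "F - m - g ^ t * F \<le> real t * (F - q)"
    by (simp add: algebra_simps)
  have "real t * ((1 - g) * (F - m) + 2 * m) \<le> real t * (F + q)"
    using q by (intro mult_left_mono) (auto simp: algebra_simps abs_le_iff)
  moreover have "real t * ((1 - g) * (F - m) + 2 * m) = real t * ((1 - g) * (F - m)) + 2 * (real t * m)"
    by (simp only: distrib_left mult.left_commute)
  \<comment> \<open>Since \<open>t\<close> is at least 1, the surplus \<open>2 t m\<close> covers
    the mean part \<open>m\<close> of \<open>F\<close>.\<close>
  moreover have "1 * m \<le> real t * m"
    using m t by (intro mult_right_mono) auto
  moreover have "(1 - g ^ t) * (F - m) = F - m - g ^ t * F + g ^ t * m"
    by (simp add: algebra_simps)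
  ultimately show "F - g ^ t * F \<le> real t * (F + q)"
    using * gm m by linarith
qed

section \<open>The exact kernel as an instance, and integration of the fibre bounds\<close>

context hybrid_augmentation
begin

text \<open>Exact sampling is the inner kernel that draws from \<open>P1 z\<close> whatever the
  current state, so every fact on hybrid kernels transfers to \<open>DA_exact\<close>.\<close>

lemma exact_augmentation: "hybrid_augmentation P P1 P2 M1 M2 (\<lambda>z y. P1 z)"
proof (rule hybrid_augmentation.intro[OF prob_P sets_P M1_def M2_def cond2 cond1])
  fix z
  show "markov_kernel (\<lambda>y. P1 z)"
    unfolding markov_kernel_def
    by (rule measurable_const) (simp add: space_prob_algebra B.prob_space_kernel)
  show "reversible (P1 z) (\<lambda>y. P1 z)"
    by (auto simp: reversible_def nn_integral_cmult_indicator intro: mult.commute)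
next
  fix A :: "'a set" assume [measurable]: "A \<in> sets borel"
  show "(\<lambda>(y, z). emeasure (P1 z) A) \<in> borel_measurable (borel \<Otimes>\<^sub>M borel)"
    by measurable
qed

text \<open>Under exact sampling the image of \<open>f\<close> on a fibre is the constant fibre
  mean, so the fibre form is the squared mean.\<close>

lemma
  assumes f: "f \<in> L2 M1"
  shows integrable_fibre_mean_square: "integrable M2 (\<lambda>z. (\<integral>x. f x \<partial>P1 z)\<^sup>2)"
    and integral_fibre_mean_square:
      "L2_inner M1 f (kernel_op (DA_exact P1 P2) f) = (\<integral>z. (\<integral>x. f x \<partial>P1 z)\<^sup>2 \<partial>M2)"
proof -
  interpret E: hybrid_augmentation P P1 P2 M1 M2 "\<lambda>z y. P1 z"
    by (rule exact_augmentation)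
  have "DA_hybrid (\<lambda>z y. P1 z) P2 = DA_exact P1 P2"
    by (simp add: DA_hybrid_def DA_exact_def fun_eq_iff)
  moreover have "L2_inner (P1 z) f (kernel_op (\<lambda>y. P1 z) f) = (\<integral>x. f x \<partial>P1 z)\<^sup>2" for z
    by (simp add: L2_inner_def kernel_op_def power2_eq_square)
  ultimately show "integrable M2 (\<lambda>z. (\<integral>x. f x \<partial>P1 z)\<^sup>2)"
    "L2_inner M1 f (kernel_op (DA_exact P1 P2) f) = (\<integral>z. (\<integral>x. f x \<partial>P1 z)\<^sup>2 \<partial>M2)"
    using E.integrable_fibre_inner[OF f] E.integral_fibre_inner[OF f] by simp_all
qed

lemma exact_reversible_kernel: "reversible_kernel M1 (DA_exact P1 P2)"
proof -
  interpret E: hybrid_augmentation P P1 P2 M1 M2 "\<lambda>z y. P1 z"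
    by (rule exact_augmentation)
  have "DA_hybrid (\<lambda>z y. P1 z) P2 = DA_exact P1 P2"
    by (simp add: DA_hybrid_def DA_exact_def fun_eq_iff)
  then show ?thesis
    using E.H.reversible_kernel_axioms by simp
qed

text \<open>The hypothesis averages \<delta> over \<open>P2 y\<close>, while the weighted energy is
  an integral over \<open>M2\<close>. Disintegrating the other way puts \<open>z\<close> innermost
  for fixed \<open>y\<close>, where \<alpha> bounds the weight.\<close>

lemma
  fixes \<delta> :: "'b \<Rightarrow> real"
  assumes \<delta> [measurable]: "\<delta> \<in> borel_measurable borel" and \<delta>01: "\<And>z. 0 \<le> \<delta> z" "\<And>z. \<delta> z \<le> 1"
    and bound: "AE y in M1. (\<integral>z. \<delta> z \<partial>P2 y) \<le> \<alpha>" and \<alpha>: "0 \<le> \<alpha>" and f: "f \<in> L2 M1"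
  shows integrable_weighted_fibre_square: "integrable M2 (\<lambda>z. \<delta> z * L2_inner (P1 z) f f)"
    and integral_weighted_fibre_square: "(\<integral>z. \<delta> z * L2_inner (P1 z) f f \<partial>M2) \<le> \<alpha> * L2_inner M1 f f"
proof -
  note [measurable] = H.L2_borel_measurable[OF f]
  have mF: "(\<lambda>z. L2_inner (P1 z) f f) \<in> borel_measurable M2"
    by (rule borel_measurable_integrable[OF integrable_fibre_square[OF f]])
  show int: "integrable M2 (\<lambda>z. \<delta> z * L2_inner (P1 z) f f)"
  proof (rule Bochner_Integration.integrable_bound[OF integrable_fibre_square[OF f]])
    show "(\<lambda>z. \<delta> z * L2_inner (P1 z) f f) \<in> borel_measurable M2"
      using mF by measurable
    show "AE z in M2. norm (\<delta> z * L2_inner (P1 z) f f) \<le> norm (L2_inner (P1 z) f f)"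
      using \<delta>01 by (auto simp: abs_mult intro!: mult_left_le_one_le)
  qed
  have "ennreal (\<integral>z. \<delta> z * L2_inner (P1 z) f f \<partial>M2) = (\<integral>\<^sup>+z. ennreal (\<delta> z * L2_inner (P1 z) f f) \<partial>M2)"
    by (rule nn_integral_eq_integral[symmetric, OF int]) (simp add: \<delta>01 L2_inner_self_nonneg)
  also have "\<dots> = (\<integral>\<^sup>+z. (\<integral>\<^sup>+y. ennreal (\<delta> z) * ennreal ((f y)\<^sup>2) \<partial>P1 z) \<partial>M2)"
  proof (rule nn_integral_cong_AE)
    show "AE z in M2. ennreal (\<delta> z * L2_inner (P1 z) f f) = (\<integral>\<^sup>+y. ennreal (\<delta> z) * ennreal ((f y)\<^sup>2) \<partial>P1 z)"
      using AE_fibre_L2[OF f]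
    proof eventually_elim
      case (elim z)
      have [measurable]: "f \<in> borel_measurable (P1 z)"
        using elim by (rule L2_measurable)
      have "(\<integral>\<^sup>+y. ennreal (\<delta> z) * ennreal ((f y)\<^sup>2) \<partial>P1 z) = ennreal (\<delta> z) * (\<integral>\<^sup>+y. ennreal ((f y)\<^sup>2) \<partial>P1 z)"
        by (rule nn_integral_cmult) measurable
      also have "(\<integral>\<^sup>+y. ennreal ((f y)\<^sup>2) \<partial>P1 z) = ennreal (L2_inner (P1 z) f f)"
        using nn_integral_eq_integral[OF L2_square_integrable[OF elim]]
        by (simp add: L2_inner_def power2_eq_square)
      finally show ?case
        by (simp add: ennreal_mult \<delta>01 L2_inner_self_nonneg)
    qed
  qed
  \<comment> \<open>The exchange of order; nonnegativity makes it available without integrability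
    conditions.\<close>
  also have "\<dots> = (\<integral>\<^sup>+y. (\<integral>\<^sup>+z. ennreal (\<delta> z) * ennreal ((f y)\<^sup>2) \<partial>P2 y) \<partial>M1)"
    using nn_integral_disintegrate[of "\<lambda>w. ennreal (\<delta> (snd w)) * ennreal ((f (fst w))\<^sup>2)"] by simp
  also have "\<dots> \<le> (\<integral>\<^sup>+y. ennreal (\<alpha> * (f y)\<^sup>2) \<partial>M1)"
  proof (rule nn_integral_mono_AE)
    show "AE y in M1. (\<integral>\<^sup>+z. ennreal (\<delta> z) * ennreal ((f y)\<^sup>2) \<partial>P2 y) \<le> ennreal (\<alpha> * (f y)\<^sup>2)"
      using bound
    proof eventually_elim
      case (elim y)
      interpret Y: prob_space "P2 y"
        by (rule A.prob_space_kernel)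
      have [measurable]: "\<delta> \<in> borel_measurable (P2 y)"
        by (subst measurable_cong_sets[OF A.sets_kernel_borel refl]) (rule \<delta>)
      have "integrable (P2 y) \<delta>"
        by (rule Y.integrable_const_bound[of _ 1]) (auto simp: \<delta>01)
      then have "(\<integral>\<^sup>+z. ennreal (\<delta> z) \<partial>P2 y) = ennreal (\<integral>z. \<delta> z \<partial>P2 y)"
        by (rule nn_integral_eq_integral) (simp add: \<delta>01)
      also have "\<dots> \<le> ennreal \<alpha>"
        using elim by (rule ennreal_leI)
      finally have "(\<integral>\<^sup>+z. ennreal (\<delta> z) \<partial>P2 y) * ennreal ((f y)\<^sup>2) \<le> ennreal \<alpha> * ennreal ((f y)\<^sup>2)"
        by (rule mult_right_mono) simp
      then show ?case
        using \<alpha> by (simp add: nn_integral_multc ennreal_mult)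
    qed
  qed
  also have "\<dots> = ennreal (\<integral>y. \<alpha> * (f y)\<^sup>2 \<partial>M1)"
    by (rule nn_integral_eq_integral) (use L2_square_integrable[OF f] \<alpha> in auto)
  also have "(\<integral>y. \<alpha> * (f y)\<^sup>2 \<partial>M1) = \<alpha> * L2_inner M1 f f"
    by (simp add: L2_inner_def power2_eq_square)
  finally show "(\<integral>z. \<delta> z * L2_inner (P1 z) f f \<partial>M2) \<le> \<alpha> * L2_inner M1 f f"
    using \<alpha> by (subst (asm) ennreal_le_iff) (auto simp: L2_inner_self_nonneg)
qed

text \<open>The fibre bounds are integrated over \<open>M2\<close>. The weight
  \<open>\<gamma> z ^ t\<close> enters only through the weighted energy, which is at most \<alpha>
  times the squared norm.\<close>

lemma
  fixes \<gamma> :: "'b \<Rightarrow> real"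
  assumes \<gamma> [measurable]: "\<gamma> \<in> borel_measurable borel" and \<gamma>01: "\<And>z. \<gamma> z \<in> {0..1}"
    and norm_le: "AE z in M2. kernel_norm (P1 z) (Q z) \<le> \<gamma> z"
    and t: "t > 0" and \<alpha>: "0 \<le> \<alpha>"
    and bound: "AE y in M1. (\<integral>z. \<gamma> z ^ t \<partial>P2 y) \<le> \<alpha>" and f: "f \<in> L2 M1"
  shows hybrid_energy_lower:
      "L2_inner M1 f f - L2_inner M1 f (kernel_op (DA_exact P1 P2) f) - \<alpha> * L2_inner M1 f f
        \<le> real t * (L2_inner M1 f f - L2_inner M1 f (kernel_op (DA_hybrid Q P2) f))"
    and hybrid_energy_upper:
      "L2_inner M1 f f - \<alpha> * L2_inner M1 f f
        \<le> real t * (L2_inner M1 f f + L2_inner M1 f (kernel_op (DA_hybrid Q P2) f))"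
proof -
  let ?F = "\<lambda>z. L2_inner (P1 z) f f" and ?m = "\<lambda>z. (\<integral>x. f x \<partial>P1 z)\<^sup>2"
  let ?q = "\<lambda>z. L2_inner (P1 z) f (kernel_op (Q z) f)" and ?g = "\<lambda>z. \<gamma> z ^ t * L2_inner (P1 z) f f"
  have \<gamma>t: "(\<lambda>z. \<gamma> z ^ t) \<in> borel_measurable borel" "0 \<le> \<gamma> z ^ t" "\<gamma> z ^ t \<le> 1" for z
    using \<gamma>01[of z] by (auto intro: power_le_one)
  have iF: "integrable M2 ?F" and im: "integrable M2 ?m" and iq: "integrable M2 ?q" and ig: "integrable M2 ?g"
    by (rule integrable_fibre_square[OF f] integrable_fibre_mean_square[OF f] integrable_fibre_inner[OF f]
        integrable_weighted_fibre_square[OF \<gamma>t bound \<alpha> f])+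
  have g: "(\<integral>z. ?g z \<partial>M2) \<le> \<alpha> * L2_inner M1 f f"
    by (rule integral_weighted_fibre_square[OF \<gamma>t bound \<alpha> f])
  have fibre: "AE z in M2. ?F z - ?m z - ?g z \<le> real t * (?F z - ?q z) \<and> ?F z - ?g z \<le> real t * (?F z + ?q z)"
    using AE_fibre_L2[OF f] norm_le
  proof eventually_elim
    case (elim z)
    interpret Qz: reversible_kernel "P1 z" "Q z"
      by (rule fibre_reversible_kernel)
    have "\<bar>?q z - ?m z\<bar> \<le> kernel_norm (P1 z) (Q z) * (?F z - ?m z)"
      by (rule Qz.inner_kernel_op_minus_mean[OF elim(1)])
    also have "\<dots> \<le> \<gamma> z * (?F z - ?m z)"
      using Qz.square_expectation_le_inner[OF elim(1)] by (intro mult_right_mono elim(2)) simp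
    finally have q: "\<bar>?q z - ?m z\<bar> \<le> \<gamma> z * (?F z - ?m z)" .
    have \<gamma>z: "0 \<le> \<gamma> z" "\<gamma> z \<le> 1"
      using \<gamma>01[of z] by auto
    show ?case
      using fibre_energy_bounds[OF zero_le_power2 Qz.square_expectation_le_inner[OF elim(1)] q \<gamma>z t] by simp
  qed
  have "(\<integral>z. ?F z - ?m z - ?g z \<partial>M2) \<le> (\<integral>z. real t * (?F z - ?q z) \<partial>M2)"
    using fibre by (intro integral_mono_AE) (auto intro!: iF im iq ig)
  then show "L2_inner M1 f f - L2_inner M1 f (kernel_op (DA_exact P1 P2) f) - \<alpha> * L2_inner M1 f f
        \<le> real t * (L2_inner M1 f f - L2_inner M1 f (kernel_op (DA_hybrid Q P2) f))"
    using g by (simp add: iF im iq ig integral_fibre_square[OF f] integral_fibre_mean_square[OF f]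
        integral_fibre_inner[OF f])
  have "(\<integral>z. ?F z - ?g z \<partial>M2) \<le> (\<integral>z. real t * (?F z + ?q z) \<partial>M2)"
    using fibre by (intro integral_mono_AE) (auto intro!: iF im iq ig)
  then show "L2_inner M1 f f - \<alpha> * L2_inner M1 f f
        \<le> real t * (L2_inner M1 f f + L2_inner M1 f (kernel_op (DA_hybrid Q P2) f))"
    using g by (simp add: iF im iq ig integral_fibre_square[OF f] integral_fibre_mean_square[OF f]
        integral_fibre_inner[OF f])
qed

end

theorem corollary13:
  fixes P :: "('a::polish_space \<times> 'b::polish_space) measure"
    and P1 :: "'b \<Rightarrow> 'a measure" and P2 :: "'a \<Rightarrow> 'b measure"
    and M1 :: "'a measure" and M2 :: "'b measure"
    and Q :: "'b \<Rightarrow> 'a \<Rightarrow> 'a measure"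
    and S S_hat :: "'a \<Rightarrow> 'a measure"
    and \<gamma> :: "'b \<Rightarrow> real" and t :: nat and \<alpha> :: real and f :: "'a \<Rightarrow> real"
  assumes "prob_space P" and "sets P = sets borel"
    and "M1 = distr P borel fst" and "M2 = distr P borel snd"
    and "cond_distribution P snd fst P2"
    and "cond_distribution P fst snd P1"
    and "\<And>z. markov_kernel (Q z)"
    and "\<And>z. reversible (P1 z) (Q z)"
    and "\<And>A. A \<in> sets borel \<Longrightarrow>
           (\<lambda>(y, z). emeasure (Q z y) A) \<in> borel_measurable (borel \<Otimes>\<^sub>M borel)"
    and "S = DA_exact P1 P2" and "S_hat = DA_hybrid Q P2"
    and "\<gamma> \<in> borel_measurable borel" and "\<And>z. \<gamma> z \<in> {0..1}"
    and "AE z in M2. kernel_norm (P1 z) (Q z) \<le> \<gamma> z"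
    and "t > 0" and "\<alpha> \<in> {0..1}"
    and "AE y in M1. (\<integral>z. \<gamma> z ^ t \<partial>P2 y) \<le> \<alpha>"
    and "\<alpha> \<le> (1 - kernel_norm M1 S) / 2"
    and "even t \<or> positive_semidefinite M1 S"
    and "kernel_norm M1 S < 1"
    and "f \<in> L2_0 M1"
  shows "asymp_var M1 S_hat f
           \<le> ereal (2 * real t) * asymp_var M1 S f + ereal ((2 * real t - 1) * (L2_norm M1 f)\<^sup>2)"
proof -
  interpret hybrid_augmentation P P1 P2 M1 M2 Q
    by (rule hybrid_augmentation.intro[OF assms(1-9)])
  note S_def = assms(10) and S_hat_def = assms(11)
  have S: "reversible_kernel M1 S" and H: "reversible_kernel M1 S_hat"
    unfolding S_def S_hat_def by (rule exact_reversible_kernel H.reversible_kernel_axioms)+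
  interpret S: reversible_kernel M1 S
    by (rule S)
  interpret S_hat: reversible_kernel M1 S_hat
    by (rule H)
  define \<rho> where "\<rho> = kernel_norm M1 S"
  \<comment> \<open>The value obtained by solving \<open>(1 - \<rho>) F \<le> 2 t (F - q)\<close>
    for \<open>q\<close>.\<close>
  define r where "r = 1 - (1 - \<rho>) / (2 * real t)"
  have \<rho>: "0 \<le> \<rho>" "\<rho> < 1"
    using S.kernel_norm_nonneg assms(20) by (simp_all add: \<rho>_def)
  have t: "1 \<le> real t"
    using assms(15) by simp
  \<comment> \<open>Keeps \<open>r\<close> away from 0;
    \<open>contraction_of_numerical_range\<close> needs a positive bound.\<close>
  have "(1 - \<rho>) / (2 * real t) \<le> 1 / 2"
    using \<rho> t by (simp add: field_simps)
  then have r: "0 < r" "r < 1"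
    using \<rho> t by (simp_all add: r_def)
  have \<alpha>: "0 \<le> \<alpha>" "\<alpha> \<le> (1 - \<rho>) / 2"
    using assms(16,18) by (simp_all add: \<rho>_def)
  have energy: "L2_inner M1 g g - L2_inner M1 g (kernel_op S g)
        \<le> 2 * real t * (L2_inner M1 g g - L2_inner M1 g (kernel_op S_hat g))" (is ?dirichlet)
    and range: "\<bar>L2_inner M1 g (kernel_op S_hat g)\<bar> \<le> r * L2_inner M1 g g" (is ?range)
    if g: "g \<in> L2_0 M1" for g
  proof -
    let ?F = "L2_inner M1 g g" and ?s = "L2_inner M1 g (kernel_op S g)"
      and ?q = "L2_inner M1 g (kernel_op S_hat g)"
    have gL: "g \<in> L2 M1"
      using g L2_0_subset_L2 by auto
    note bounds = hybrid_energy_lower[OF assms(12-15) \<alpha>(1) assms(17) gL]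
      hybrid_energy_upper[OF assms(12-15) \<alpha>(1) assms(17) gL]
    have F: "0 \<le> ?F"
      by (rule L2_inner_self_nonneg)
    have s: "?s \<le> \<rho> * ?F"
      using S.inner_kernel_op_le[OF g] by (simp add: \<rho>_def)
    have aF: "\<alpha> * ?F \<le> (1 - \<rho>) / 2 * ?F"
      by (rule mult_right_mono[OF \<alpha>(2) F])
    have lower: "?F - ?s - \<alpha> * ?F \<le> real t * (?F - ?q)"
      and upper: "?F - \<alpha> * ?F \<le> real t * (?F + ?q)"
      using bounds unfolding S_def S_hat_def .
    \<comment> \<open>By \<open>aF\<close> and \<open>s\<close>, the \<alpha> term costs at most
      half of \<open>?F - ?s\<close>; the remaining half accounts for the factor 2.\<close>
    from lower show ?dirichlet
      using aF s by (simp add: algebra_simps)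
    then have "(1 - \<rho>) * ?F \<le> 2 * real t * (?F - ?q)"
      using s by (simp add: algebra_simps)
    then have 1: "?q \<le> r * ?F"
      using t by (simp add: r_def field_simps)
    have "0 \<le> \<rho> * ?F"
      using \<rho> F by simp
    \<comment> \<open>The left side of \<open>upper\<close> is at least
      \<open>(1 + \<rho>) / 2 * ?F\<close>, which exceeds what is needed by
      \<open>\<rho> * ?F\<close>.\<close>
    then have "(1 - \<rho>) * ?F \<le> 2 * real t * (?F + ?q)"
      using upper aF F by (simp add: algebra_simps)
    then have "- ?q \<le> r * ?F"
      using t by (simp add: r_def field_simps)
    with 1 show ?range
      by simp
  qed
  have contrS: "L2_norm M1 (kernel_op S g) \<le> \<rho> * L2_norm M1 g" if "g \<in> L2_0 M1" for g
    unfolding \<rho>_def by (rule S.kernel_op_norm_le_kernel_norm[OF that])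
  have contrH: "L2_norm M1 (kernel_op S_hat g) \<le> r * L2_norm M1 g" if "g \<in> L2_0 M1" for g
    by (rule S_hat.contraction_of_numerical_range[OF range r(1) that])
  have psd: "L2_inner M1 g (kernel_op S g) \<le> L2_inner M1 g g" if "g \<in> L2_0 M1" for g
  proof -
    have "L2_inner M1 g (kernel_op S g) \<le> \<rho> * L2_inner M1 g g"
      using S.inner_kernel_op_le[OF that] by (simp add: \<rho>_def)
    also have "\<dots> \<le> 1 * L2_inner M1 g g"
      using \<rho> by (intro mult_right_mono L2_inner_self_nonneg) auto
    finally show ?thesis
      by simp
  qed
  note f = assms(21)
  have "(\<Sum>k. L2_inner M1 f ((kernel_op S_hat ^^ k) f)) \<le> 2 * real t * (\<Sum>k. L2_inner M1 f ((kernel_op S ^^ k) f))"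
    using t r by (intro resolvent_comparison[OF S H contrS \<rho> contrH _ r(2) psd energy _ f]) auto
  moreover have "asymp_var M1 S f
      = ereal (2 * (\<Sum>k. L2_inner M1 f ((kernel_op S ^^ k) f)) - (L2_norm M1 f)\<^sup>2)"
    by (rule S.asymp_var_eq_suminf[OF contrS \<rho> f])
  moreover have "asymp_var M1 S_hat f
      = ereal (2 * (\<Sum>k. L2_inner M1 f ((kernel_op S_hat ^^ k) f)) - (L2_norm M1 f)\<^sup>2)"
    by (rule S_hat.asymp_var_eq_suminf[OF contrH less_imp_le[OF r(1)] r(2) f])
  \<comment> \<open>Passing from sums to asymptotic variances, the norm terms differ by
    \<open>2 t - 1\<close> squared norms of \<open>f\<close>, the additive term of the
    claim.\<close>
  ultimately show ?thesis
    by (simp add: algebra_simps)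
qed

end
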